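(* Let $G$ be a finite connected graph without loops or multiple edges, with $n$ vertices and $m$ edges, and let $w$ be a quaternionic weight on its arcs. Then \[ {\bf Z}_{\mathbb{H}}(G,w,t)^{-1}=\mathrm{Sdet}_t\bigl({\bf I}_n-t\tilde{\bf W}+t^2\tilde{\bf D}\bigr)\prod_{i=1}^m\bigl(1-w(e_i)w(e_i^{-1})t^2\bigr)\bigl(1-w(e_i)w(e_i^{-1})t^2\bigr)^*. \]
   Context: $\mathbb{H}$ is the real quaternion algebra, $\mathbb{C}=\mathbb{R}+\mathbb{R}i\subset\mathbb{H}$, $x^*=x_0-x_1i-x_2j-x_3k$ for $x=x_0+x_1i+x_2j+x_3k$. $\mathbb{H}[[t]]$ is the ring of formal power series in a central indeterminate $t$, $\alpha^*=\sum\alpha_k^*t^k$; elements with constant term $1$ are invertible. Study determinant: each quaternionic matrix is uniquely ${\bf M}={\bf M}^S+j{\bf M}^P$ with complex ${\bf M}^S,{\bf M}^P$; $\psi({\bf M})=\begin{bmatrix}{\bf M}^S&-\overline{{\bf M}^P}\\ {\bf M}^P&\overline{{\bf M}^S}\end{bmatrix}$; for a square matrix ${\bf M}=\sum_k{\bf M}_kt^k$ over $\mathbb{H}[[t]]$, $\psi_t({\bf M})=\sum_k\psi({\bf M}_k)t^k$ and $\mathrm{Sdet}_t({\bf M})=\det(\psi_t({\bf M}))\in\mathbb{C}[[t]]$. Graph notions: $D(G)$ is the set of arcs, $o(e),t(e)$ origin and terminus, $e^{-1}$ the reverse arc; arcs are enumerated $e_1,\dots,e_{2m}$ with $e_{m+k}=e_k^{-1}$.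 A quaternionic weight is $w:V(G)\times V(G)\to\mathbb{H}$ vanishing off $D(G)$, $w(e)=w(u,v)$ for $e=(u,v)$; for a path $P=(f_1,\dots,f_\ell)$, $w(P)=w(f_1)\cdots w(f_\ell)$, $|P|=\ell$. A cycle is a path with $t(f_\ell)=o(f_1)$; it has a backtracking if $f_{i+1}=f_i^{-1}$ for some $i$; it is reduced if neither $C$ nor $C^2$ has a backtracking. $L_{[2m]}$ is the set of Lyndon words over $\{1<\dots<2m\}$. ${\bf Z}_{\mathbb{H}}(G,w,t)=\prod_{C}\{(1-w(C)t^{|C|})(1-w(C)t^{|C|})^*\}^{-1}$, where $C$ runs over reduced cycles $(e_{i_1},\dots,e_{i_r})$ with $i_1\cdots i_r\in L_{[2m]}$. $\tilde{\bf W}=(\tilde{\bf W}_{uv})$ and $\tilde{\bf D}=(\tilde{\bf D}_{uv})$ are the $n\times n$ matrices over $\mathbb{H}[[t]]$ indexed by $V(G)$ with $\tilde{\bf W}_{uv}=(1-w(e)w(e^{-1})t^2)^{-1}w(e)$ if $e=(u,v)\in D(G)$ and $0$ otherwise, and $\tilde{\bf D}_{uv}=\delta_{uv}\sum_{e\in D(G),\,o(e)=u}(1-w(e)w(e^{-1})t^2)^{-1}w(e)w(e^{-1})$. *)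

theory Defs
  imports
    Complex_Main
    "HOL-Computational_Algebra.Formal_Power_Series"
    "Jordan_Normal_Form.Determinant"
    "Graph_Theory.Pair_Digraph"
    "Graph_Theory.Digraph_Component"
begin

section \<open>Quaternions\<close>

codatatype quat = Quat (Q0: real) (Q1: real) (Q2: real) (Q3: real)

lemma quat_eq_iff: "x = y \<longleftrightarrow> Q0 x = Q0 y \<and> Q1 x = Q1 y \<and> Q2 x = Q2 y \<and> Q3 x = Q3 y"
  by (auto intro: quat.expand)

instantiation quat :: ring_1
begin

primcorec zero_quat where
  "Q0 0 = 0" | "Q1 0 = 0" | "Q2 0 = 0" | "Q3 0 = 0"

primcorec one_quat where
  "Q0 1 = 1" | "Q1 1 = 0" | "Q2 1 = 0" | "Q3 1 = 0"

primcorec plus_quat where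
  "Q0 (x + y) = Q0 x + Q0 y"
| "Q1 (x + y) = Q1 x + Q1 y"
| "Q2 (x + y) = Q2 x + Q2 y"
| "Q3 (x + y) = Q3 x + Q3 y"

primcorec uminus_quat where
  "Q0 (- x) = - Q0 x" | "Q1 (- x) = - Q1 x" | "Q2 (- x) = - Q2 x" | "Q3 (- x) = - Q3 x"

primcorec minus_quat where
  "Q0 (x - y) = Q0 x - Q0 y"
| "Q1 (x - y) = Q1 x - Q1 y"
| "Q2 (x - y) = Q2 x - Q2 y"
| "Q3 (x - y) = Q3 x - Q3 y"

primcorec times_quat where
  "Q0 (x * y) = Q0 x * Q0 y - Q1 x * Q1 y - Q2 x * Q2 y - Q3 x * Q3 y"
| "Q1 (x * y) = Q0 x * Q1 y + Q1 x * Q0 y + Q2 x * Q3 y - Q3 x * Q2 y"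
| "Q2 (x * y) = Q0 x * Q2 y - Q1 x * Q3 y + Q2 x * Q0 y + Q3 x * Q1 y"
| "Q3 (x * y) = Q0 x * Q3 y + Q1 x * Q2 y - Q2 x * Q1 y + Q3 x * Q0 y"

instance
  by standard (simp_all add: quat_eq_iff algebra_simps)

end

primcorec qcnj :: "quat \<Rightarrow> quat" where
  "Q0 (qcnj x) = Q0 x"
| "Q1 (qcnj x) = - Q1 x"
| "Q2 (qcnj x) = - Q2 x"
| "Q3 (qcnj x) = - Q3 x"

definition qnormsq :: "quat \<Rightarrow> real" where
  "qnormsq x = (Q0 x)\<^sup>2 + (Q1 x)\<^sup>2 + (Q2 x)\<^sup>2 + (Q3 x)\<^sup>2"

lemma qnormsq_nonzero: "x \<noteq> 0 \<Longrightarrow> qnormsq x \<noteq> 0"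
  by (auto simp: qnormsq_def quat_eq_iff add_nonneg_eq_0_iff)

instantiation quat :: inverse
begin

definition inverse_quat :: "quat \<Rightarrow> quat" where
  "inverse x = Quat (Q0 x / qnormsq x) (- Q1 x / qnormsq x) (- Q2 x / qnormsq x) (- Q3 x / qnormsq x)"

definition divide_quat :: "quat \<Rightarrow> quat \<Rightarrow> quat" where
  "x div y = x * inverse (y :: quat)"

instance ..

end

instance quat :: division_ring
proof
  fix x y :: quat
  show "x / y = x * inverse y" by (simp add: divide_quat_def)
  show "inverse (0::quat) = 0" by (simp add: inverse_quat_def quat_eq_iff)
  assume "x \<noteq> 0"
  then have n: "qnormsq x \<noteq> 0" by (rule qnormsq_nonzero)
  have q: "Q0 x * Q0 x + Q1 x * Q1 x + Q2 x * Q2 x + Q3 x * Q3 x = qnormsq x"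
    by (simp add: qnormsq_def power2_eq_square)
  show "inverse x * x = 1" and "x * inverse x = 1"
    using n q
    by (simp_all add: quat_eq_iff inverse_quat_def mult.commute
        flip: add_divide_distrib diff_divide_distrib)
qed

definition quat_of_complex :: "complex \<Rightarrow> quat" where
  "quat_of_complex z = Quat (Re z) (Im z) 0 0"

definition quat_j :: quat where
  "quat_j = Quat 0 0 1 0"

definition simplex_part :: "quat \<Rightarrow> complex" where
  "simplex_part x = Complex (Q0 x) (Q1 x)"

text \<open>The minus sign comes from \<open>j i = - k\<close>.\<close>

definition perplex_part :: "quat \<Rightarrow> complex" where
  "perplex_part x = Complex (Q2 x) (- Q3 x)"

lemma simplex_perplex_decomposition:
  "x = quat_of_complex a + quat_j * quat_of_complex b \<longleftrightarrow>
     a = simplex_part x \<and> b = perplex_part x"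
  by (auto simp: quat_eq_iff complex_eq_iff quat_of_complex_def quat_j_def
      simplex_part_def perplex_part_def)

lemma qcnj_add: "qcnj (x + y) = qcnj x + qcnj y"
  by (simp add: quat_eq_iff)

lemma qcnj_mult: "qcnj (x * y) = qcnj y * qcnj x"
  by (simp add: quat_eq_iff algebra_simps)

lemma qcnj_qcnj: "qcnj (qcnj x) = x"
  by (simp add: quat_eq_iff)

lemma qcnj_sum: "qcnj (\<Sum>i\<in>A. f i) = (\<Sum>i\<in>A. qcnj (f i))"
proof (induction A rule: infinite_finite_induct)
  case (insert a A)
  then show ?case by (simp add: qcnj_add)
qed (simp_all add: quat_eq_iff)

lemma qcnj_fixed_central:
  assumes "qcnj x = x"
  shows "x * y = y * x"
proof -
  have "Q1 x = 0" "Q2 x = 0" "Q3 x = 0"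
    using assms by (simp_all add: quat_eq_iff)
  then show ?thesis by (simp add: quat_eq_iff algebra_simps)
qed

section \<open>Power series over the quaternions\<close>

definition fps_qcnj :: "quat fps \<Rightarrow> quat fps" where
  "fps_qcnj f = Abs_fps (\<lambda>k. qcnj (fps_nth f k))"

definition fps_quat_of_complex :: "complex fps \<Rightarrow> quat fps" where
  "fps_quat_of_complex f = Abs_fps (\<lambda>k. quat_of_complex (fps_nth f k))"

definition fps_qnormsq :: "quat fps \<Rightarrow> quat fps" where
  "fps_qnormsq f = f * fps_qcnj f"

text \<open>
  Series of the form \<open>f f\<^sup>*\<close> are central, although the ring itself is not commutative.
  The products below only involve such series and their inverses.
\<close>

lemma fps_qnormsq_central: "fps_qnormsq f * g = g * fps_qnormsq f"
proof -
  have "qcnj (fps_nth (fps_qnormsq f) n) = fps_nth (fps_qnormsq f) n" for n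
  proof -
    have "qcnj (fps_nth (fps_qnormsq f) n) = (\<Sum>i=0..n. fps_nth f (n - i) * qcnj (fps_nth f i))"
      by (simp add: fps_qnormsq_def fps_qcnj_def fps_mult_nth qcnj_sum qcnj_mult qcnj_qcnj)
    also have "\<dots> = (\<Sum>i=0..n. fps_nth f i * qcnj (fps_nth f (n - i)))"
      by (rule sum.reindex_bij_witness[of _ "\<lambda>i. n - i" "\<lambda>i. n - i"]) auto
    finally show ?thesis by (simp add: fps_qnormsq_def fps_qcnj_def fps_mult_nth)
  qed
  note c = qcnj_fixed_central[OF this]
  show ?thesis
  proof (rule fps_ext)
    fix n
    have "fps_nth (fps_qnormsq f * g) n = (\<Sum>i=0..n. fps_nth g (n - i) * fps_nth (fps_qnormsq f) i)"
      unfolding fps_mult_nth by (simp add: c)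
    also have "\<dots> = (\<Sum>i=0..n. fps_nth g i * fps_nth (fps_qnormsq f) (n - i))"
      by (rule sum.reindex_bij_witness[of _ "\<lambda>i. n - i" "\<lambda>i. n - i"]) auto
    finally show "fps_nth (fps_qnormsq f * g) n = fps_nth (g * fps_qnormsq f) n"
      by (simp add: fps_mult_nth)
  qed
qed

lemma fps_inverse_qnormsq_central:
  assumes "fps_nth f 0 = 1"
  shows "inverse (fps_qnormsq f) * g = g * inverse (fps_qnormsq f)"
proof -
  let ?h = "fps_qnormsq f"
  have "fps_nth ?h 0 = 1"
    using assms by (simp add: fps_qnormsq_def fps_qcnj_def quat_eq_iff)
  then have l: "inverse ?h * ?h = 1" and r: "?h * inverse ?h = 1"
    by (simp_all add: inverse_mult_eq_1 inverse_mult_eq_1')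
  have "inverse ?h * g = inverse ?h * g * (?h * inverse ?h)" by (simp add: r)
  also have "\<dots> = inverse ?h * (g * ?h) * inverse ?h" by (simp only: mult.assoc)
  also have "\<dots> = inverse ?h * (?h * g) * inverse ?h" by (simp only: fps_qnormsq_central)
  also have "\<dots> = (inverse ?h * ?h) * g * inverse ?h" by (simp only: mult.assoc)
  finally show ?thesis by (simp add: l)
qed

text \<open>
  The finite and infinite products over a set \<open>A\<close> of pairwise commuting factors in a ring that need
  not be commutative. The infinite product is the limit of the finite partial products along the
  finite subsets of \<open>A\<close>, for the \<open>t\<close>-adic topology on power series.
\<close>

definition comm_prod :: "('b \<Rightarrow> 'a::monoid_mult) \<Rightarrow> 'b set \<Rightarrow> 'a" where
  "comm_prod f A = Finite_Set.fold (\<lambda>x z. f x * z) 1 A"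

definition fps_infprod :: "('b \<Rightarrow> 'a::ring_1 fps) \<Rightarrow> 'b set \<Rightarrow> 'a fps" where
  "fps_infprod f A = Lim (finite_subsets_at_top A) (comm_prod f)"

section \<open>The Study determinant\<close>

definition psi :: "quat mat \<Rightarrow> complex mat" where
  "psi M = four_block_mat
     (map_mat simplex_part M) (map_mat (\<lambda>x. - cnj (perplex_part x)) M)
     (map_mat perplex_part M) (map_mat (\<lambda>x. cnj (simplex_part x)) M)"

definition psi_t :: "quat fps mat \<Rightarrow> complex fps mat" where
  "psi_t M = mat (2 * dim_row M) (2 * dim_col M)
     (\<lambda>ij. Abs_fps (\<lambda>k. psi (map_mat (\<lambda>f. fps_nth f k) M) $$ ij))"

definition Sdet_t :: "quat fps mat \<Rightarrow> complex fps" where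
  "Sdet_t M = det (psi_t M)"

section \<open>Cycles and the zeta function\<close>

text \<open>
  A graph is represented by its symmetric set of arcs, which are pairs of vertices; the reverse of
  an arc is given by \<^const>\<open>prod.swap\<close>.
\<close>

definition has_backtracking :: "('a \<times> 'a) list \<Rightarrow> bool" where
  "has_backtracking p \<longleftrightarrow> (\<exists>i. Suc i < length p \<and> p ! Suc i = prod.swap (p ! i))"

definition reduced_cycle :: "'a pair_pre_digraph \<Rightarrow> ('a \<times> 'a) list \<Rightarrow> bool" where
  "reduced_cycle G C \<longleftrightarrow>
     (\<exists>u. pre_digraph.awalk (with_proj G) u C u) \<and> C \<noteq> [] \<and>
     \<not> has_backtracking C \<and> \<not> has_backtracking (C @ C)"

definition lyndon_words :: "'a::linorder set \<Rightarrow> 'a list set" where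
  "lyndon_words A = {x. x \<noteq> [] \<and> set x \<subseteq> A \<and>
     (\<forall>k. 0 < k \<and> k < length x \<longrightarrow> (x, rotate k x) \<in> lexord {(a, b). a < b})}"

definition path_weight :: "('a \<times> 'a \<Rightarrow> quat) \<Rightarrow> ('a \<times> 'a) list \<Rightarrow> quat" where
  "path_weight w p = prod_list (map w p)"

definition zeta_H ::
  "'a pair_pre_digraph \<Rightarrow> nat \<Rightarrow> (nat \<Rightarrow> 'a \<times> 'a) \<Rightarrow> ('a \<times> 'a \<Rightarrow> quat) \<Rightarrow> quat fps" where
  "zeta_H G m e w = fps_infprod
     (\<lambda>C. inverse (fps_qnormsq (1 - fps_const (path_weight w C) * fps_X ^ length C)))
     {C. reduced_cycle G C \<and> (\<exists>x \<in> lyndon_words {1..2*m}. C = map e x)}"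

section \<open>The vertex matrices\<close>

definition edge_factor :: "('a \<times> 'a \<Rightarrow> quat) \<Rightarrow> 'a \<times> 'a \<Rightarrow> quat fps" where
  "edge_factor w a = 1 - fps_const (w a * w (prod.swap a)) * fps_X ^ 2"

text \<open>Rows and columns are indexed by the vertices \<open>v 0, \<dots>, v (n - 1)\<close>.\<close>

definition W_tilde ::
  "'a pair_pre_digraph \<Rightarrow> ('a \<times> 'a \<Rightarrow> quat) \<Rightarrow> nat \<Rightarrow> (nat \<Rightarrow> 'a) \<Rightarrow> quat fps mat" where
  "W_tilde G w n v = mat n n (\<lambda>(i, j).
     if (v i, v j) \<in> parcs G
     then inverse (edge_factor w (v i, v j)) * fps_const (w (v i, v j)) else 0)"

definition D_tilde ::
  "'a pair_pre_digraph \<Rightarrow> ('a \<times> 'a \<Rightarrow> quat) \<Rightarrow> nat \<Rightarrow> (nat \<Rightarrow> 'a) \<Rightarrow> quat fps mat" where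
  "D_tilde G w n v = mat n n (\<lambda>(i, j).
     if i = j
     then (\<Sum>a | a \<in> parcs G \<and> fst a = v i.
             inverse (edge_factor w a) * fps_const (w a * w (prod.swap a)))
     else 0)"

end

theory Submission
  imports Defs "Jordan_Normal_Form.Schur_Decomposition" "HOL-Library.List_Lexorder"
begin

text \<open>
  Series \<open>\<alpha>\<alpha>\<^sup>*\<close> have real coefficients, so the identity takes place in \<open>\<complex>[[t]]\<close>, where a series with
  constant term 1 is determined by \<open>t f' / f\<close>. If \<open>M\<close> is the matrix of non-backtracking steps between
  arcs, then for \<open>f = Sdet\<^sub>t(I - tM)\<close> this is \<open>-\<Sum>\<^sub>k 2 Re tr(M\<^sup>k) t\<^sup>k\<close>, a sum over closed
  words of arcs. The real part of the weight of a closed word is invariant under rotation, and every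
  nonempty word is, in a unique way, a rotation of a power of a Lyndon word; grouping the words
  accordingly gives the logarithmic derivative of the product over Lyndon cycles. Hence
  \<open>Z\<^sup>-\<^sup>1 = Sdet\<^sub>t(I - tM)\<close>. Finally \<open>I - tM = (I + tJ) - tKL\<close>, where \<open>J\<close> reverses arcs and
  \<open>K\<close>, \<open>L\<close> map arcs to targets and sources to arcs, and \<open>det(I - AB) = det(I - BA)\<close> moves the
  determinant from arcs to vertices. The remaining factor \<open>Sdet\<^sub>t(I + tJ)\<close> is again found from
  its logarithmic derivative.
\<close>

section \<open>Logarithmic derivatives\<close>

text \<open>This is \<open>g = t f' / f\<close>, cleared of the denominator so that no invertibility
  has to be carried along.\<close>

definition has_log_deriv :: "complex fps \<Rightarrow> complex fps \<Rightarrow> bool" where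
  "has_log_deriv f g \<longleftrightarrow> fps_X * fps_deriv f = g * f"

lemma has_log_deriv_one: "has_log_deriv 1 0"
  by (simp add: has_log_deriv_def)

lemma has_log_deriv_mult:
  assumes "has_log_deriv f g" "has_log_deriv f' g'"
  shows "has_log_deriv (f * f') (g + g')"
proof -
  have "fps_X * fps_deriv (f * f') = f * (fps_X * fps_deriv f') + (fps_X * fps_deriv f) * f'"
    by (simp add: algebra_simps)
  also have "\<dots> = (g + g') * (f * f')"
    using assms by (simp add: has_log_deriv_def algebra_simps)
  finally show ?thesis by (simp add: has_log_deriv_def)
qed

lemma has_log_deriv_prod:
  assumes "\<And>x. x \<in> A \<Longrightarrow> has_log_deriv (f x) (g x)"
  shows "has_log_deriv (prod f A) (sum g A)"
  using assms
  by (induction A rule: infinite_finite_induct) (simp_all add: has_log_deriv_one has_log_deriv_mult)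

lemma fps_X_deriv_nth: "fps_nth (fps_X * fps_deriv f) n = of_nat n * fps_nth f n"
  for f :: "complex fps"
  by (cases n) simp_all

text \<open>As \<open>g\<close> has constant term 0, comparing coefficients in
  \<open>t f' = g f\<close> gives the recursion \<open>k f_k = g_1 f_(k-1) + ... + g_k f_0\<close>.
  The bound \<open>N\<close> makes this usable for finite partial products, which match the limit
  only up to some degree.\<close>

lemma has_log_deriv_unique:
  assumes "has_log_deriv f g" "has_log_deriv f' g'"
    and "fps_nth f 0 = fps_nth f' 0" and "fps_nth g 0 = 0"
    and "\<And>k. k \<le> N \<Longrightarrow> fps_nth g k = fps_nth g' k"
    and "k \<le> N"
  shows "fps_nth f k = fps_nth f' k"
  using \<open>k \<le> N\<close>
proof (induction k rule: less_induct)
  case (less k)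
  show ?case
  proof (cases "k = 0")
    case False
    have "fps_nth g i * fps_nth f (k - i) = fps_nth g' i * fps_nth f' (k - i)" if "i \<le> k" for i
    proof (cases "i = 0")
      case True
      then show ?thesis using assms(4) assms(5)[of 0] by simp
    next
      case False
      then show ?thesis
        using that less assms(5)[of i] \<open>k \<noteq> 0\<close> by simp
    qed
    then have "fps_nth (g * f) k = fps_nth (g' * f') k"
      unfolding fps_mult_nth by (intro sum.cong) auto
    then have "fps_nth (fps_X * fps_deriv f) k = fps_nth (fps_X * fps_deriv f') k"
      using assms(1,2) by (simp add: has_log_deriv_def)
    then show ?thesis using False by (simp only: fps_X_deriv_nth) simp
  qed (simp add: assms)
qed

text \<open>The expansion of \<open>- l a t^l / (1 - a t^l)\<close>, which is
  \<open>t f' / f\<close> for \<open>f = 1 - a t^l\<close>.\<close>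

definition geom_log_deriv :: "nat \<Rightarrow> complex \<Rightarrow> complex fps" where
  "geom_log_deriv l a = - Abs_fps (\<lambda>k. if 0 < k \<and> l dvd k then of_nat l * a ^ (k div l) else 0)"

lemma has_log_deriv_linear_factor:
  assumes "0 < l"
  shows "has_log_deriv (1 - fps_const a * fps_X ^ l) (geom_log_deriv l a)"
  unfolding has_log_deriv_def
proof (rule fps_ext)
  fix n
  let ?g = "geom_log_deriv l a"
  have "?g * (1 - fps_const a * fps_X ^ l) = ?g - fps_const a * (?g * fps_X ^ l)"
    by (simp add: algebra_simps)
  then have R: "fps_nth (?g * (1 - fps_const a * fps_X ^ l)) n
      = fps_nth ?g n - a * (if n < l then 0 else fps_nth ?g (n - l))"
    by (simp add: fps_X_power_mult_right_nth)
  have L: "fps_nth (fps_X * fps_deriv (1 - fps_const a * fps_X ^ l)) n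
      = (if n = l then - of_nat l * a else 0)"
    using assms unfolding fps_X_deriv_nth by (auto simp: fps_X_power_nth)
  consider "n < l" | "n = l" | "n > l" "l dvd n" | "n > l" "\<not> l dvd n" by fastforce
  then show "fps_nth (fps_X * fps_deriv (1 - fps_const a * fps_X ^ l)) n
      = fps_nth (?g * (1 - fps_const a * fps_X ^ l)) n"
  proof cases
    case 1
    then have "\<not> (0 < n \<and> l dvd n)" by (auto dest: dvd_imp_le)
    then show ?thesis unfolding L R using 1 by (auto simp: geom_log_deriv_def)
  next
    case 2
    then show ?thesis unfolding L R using assms by (simp add: geom_log_deriv_def)
  next
    case 3
    then obtain c where c: "n = l * c" by blast
    with 3 obtain d where d: "c = Suc d" by (cases c) auto
    with c have "n - l = l * d" by (simp add: algebra_simps)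
    moreover have "d > 0" using 3 c d by (cases d) auto
    ultimately show ?thesis
      unfolding L R using assms 3 c d by (simp add: geom_log_deriv_def del: mult_Suc_right)
  next
    case 4
    then have "\<not> l dvd (n - l)" by (simp add: dvd_minus_self)
    then show ?thesis unfolding L R using 4 by (simp add: geom_log_deriv_def)
  qed
qed

text \<open>The product of \<open>1 - q t^l\<close> with its conjugate. Its coefficients are real,
  and it is kept as a complex series so that commutative algebra applies.\<close>

definition norm_factor :: "nat \<Rightarrow> quat \<Rightarrow> complex fps" where
  "norm_factor l q = 1 - fps_const (of_real (2 * Q0 q)) * fps_X ^ l
     + fps_const (of_real (qnormsq q)) * fps_X ^ (2 * l)"

text \<open>The eigenvalues of the \<open>2 \<times> 2\<close> matrix representing \<open>q\<close> are this number and its conjugate.\<close>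

definition quat_eigenvalue :: "quat \<Rightarrow> complex" where
  "quat_eigenvalue q = Complex (Q0 q) (sqrt ((Q1 q)\<^sup>2 + (Q2 q)\<^sup>2 + (Q3 q)\<^sup>2))"

lemma quat_eigenvalue_add_cnj: "quat_eigenvalue q + cnj (quat_eigenvalue q) = of_real (2 * Q0 q)"
  by (simp add: quat_eigenvalue_def complex_eq_iff)

lemma quat_eigenvalue_mult_cnj: "quat_eigenvalue q * cnj (quat_eigenvalue q) = of_real (qnormsq q)"
  by (simp add: quat_eigenvalue_def complex_eq_iff qnormsq_def power2_eq_square[symmetric])

text \<open>The Cayley-Hamilton identity for quaternions; \<open>Quat r 0 0 0\<close> is the real
  number \<open>r\<close>.\<close>

lemma quat_square: "x * x = Quat (2 * Q0 x) 0 0 0 * x - Quat (qnormsq x) 0 0 0"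
  by (simp add: quat_eq_iff qnormsq_def power2_eq_square)

text \<open>By \<open>quat_square\<close> both sides satisfy the same second-order linear recurrence
  in \<open>k\<close>, whose characteristic roots are the eigenvalue and its conjugate.\<close>

lemma Q0_power: "of_real (2 * Q0 (q ^ k)) = quat_eigenvalue q ^ k + cnj (quat_eigenvalue q) ^ k"
proof (induction k rule: induct_nat_012)
  case (ge2 k)
  let ?a = "quat_eigenvalue q" and ?b = "cnj (quat_eigenvalue q)"
  have "q ^ Suc (Suc k) = (q * q) * q ^ k" by (simp add: mult.assoc)
  also have "\<dots> = Quat (2 * Q0 q) 0 0 0 * q ^ Suc k - Quat (qnormsq q) 0 0 0 * q ^ k"
    by (subst quat_square) (simp add: algebra_simps)
  finally have "2 * Q0 (q ^ Suc (Suc k)) = 2 * Q0 q * (2 * Q0 (q ^ Suc k)) - qnormsq q * (2 * Q0 (q ^ k))"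
    by (simp del: power_Suc)
  then have "complex_of_real (2 * Q0 (q ^ Suc (Suc k)))
      = of_real (2 * Q0 q) * of_real (2 * Q0 (q ^ Suc k)) - of_real (qnormsq q) * of_real (2 * Q0 (q ^ k))"
    by (simp only: of_real_mult[symmetric] of_real_diff[symmetric])
  also have "\<dots> = (?a + ?b) * (?a ^ Suc k + ?b ^ Suc k) - (?a * ?b) * (?a ^ k + ?b ^ k)"
    by (simp only: quat_eigenvalue_add_cnj quat_eigenvalue_mult_cnj ge2)
  also have "\<dots> = ?a ^ Suc (Suc k) + ?b ^ Suc (Suc k)"
    by (simp add: algebra_simps)
  finally show ?case .
qed (simp_all add: quat_eigenvalue_add_cnj)

definition norm_factor_log_deriv :: "nat \<Rightarrow> quat \<Rightarrow> complex fps" where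
  "norm_factor_log_deriv l q =
     - Abs_fps (\<lambda>k. if 0 < k \<and> l dvd k then of_nat l * of_real (2 * Q0 (q ^ (k div l))) else 0)"

text \<open>Over the complex numbers the factor splits into two linear ones; \<open>Q0_power\<close>
  recombines the power sums of their roots.\<close>

lemma has_log_deriv_norm_factor:
  assumes "0 < l"
  shows "has_log_deriv (norm_factor l q) (norm_factor_log_deriv l q)"
proof -
  let ?a = "quat_eigenvalue q" and ?b = "cnj (quat_eigenvalue q)"
  have "(1 - fps_const ?a * fps_X ^ l) * (1 - fps_const ?b * fps_X ^ l)
      = 1 - fps_const (?a + ?b) * fps_X ^ l + fps_const (?a * ?b) * fps_X ^ (2 * l)"
    by (simp add: algebra_simps power_add mult_2_right flip: fps_const_add fps_const_mult)
  also have "\<dots> = norm_factor l q"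
    by (simp only: norm_factor_def quat_eigenvalue_add_cnj quat_eigenvalue_mult_cnj)
  finally have "has_log_deriv (norm_factor l q) (geom_log_deriv l ?a + geom_log_deriv l ?b)"
    using has_log_deriv_mult[OF has_log_deriv_linear_factor[OF assms, of ?a]
      has_log_deriv_linear_factor[OF assms, of ?b]] by simp
  also have "geom_log_deriv l ?a + geom_log_deriv l ?b = norm_factor_log_deriv l q"
    by (rule fps_ext)
      (simp only: geom_log_deriv_def norm_factor_log_deriv_def Q0_power fps_add_nth fps_neg_nth
        fps_nth_Abs_fps, simp add: algebra_simps)
  finally show ?thesis .
qed

lemma norm_factor_nth_0: "0 < l \<Longrightarrow> fps_nth (norm_factor l q) 0 = 1"
  by (simp add: norm_factor_def)

section \<open>Traces of powers and the determinant of \<open>I - tM\<close>\<close>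

definition trace :: "'a::comm_monoid_add mat \<Rightarrow> 'a" where
  "trace A = (\<Sum>i<dim_row A. A $$ (i, i))"

lemma trace_commute:
  fixes A B :: "'a::comm_semiring_0 mat"
  assumes "A \<in> carrier_mat n k" "B \<in> carrier_mat k n"
  shows "trace (A * B) = trace (B * A)"
proof -
  have "trace (A * B) = (\<Sum>i<n. \<Sum>j<k. A $$ (i, j) * B $$ (j, i))"
    using assms by (simp add: trace_def scalar_prod_def atLeast0LessThan)
  also have "\<dots> = (\<Sum>j<k. \<Sum>i<n. B $$ (j, i) * A $$ (i, j))"
    by (subst sum.swap) (simp add: mult.commute)
  also have "\<dots> = trace (B * A)"
    using assms by (simp add: trace_def scalar_prod_def atLeast0LessThan)
  finally show ?thesis .
qed

text \<open>In row \<open>i\<close> of the product \<open>B^k B\<close>, the induction hypothesis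
  kills the indices \<open>l < i\<close> and triangularity kills \<open>l > j\<close>. With
  \<open>j \<le> i\<close> only \<open>l = i\<close> can remain, so the zeros below the diagonal are
  proved along with the diagonal.\<close>

lemma upper_triangular_pow:
  fixes B :: "'a::comm_semiring_1 mat"
  assumes B: "B \<in> carrier_mat n n" and ut: "\<And>i j. j < i \<Longrightarrow> i < n \<Longrightarrow> B $$ (i, j) = 0"
  shows "j \<le> i \<Longrightarrow> i < n \<Longrightarrow> (B ^\<^sub>m k) $$ (i, j) = (if i = j then B $$ (i, i) ^ k else 0)"
proof (induction k arbitrary: i j)
  case 0
  then show ?case using B by simp
next
  case (Suc k)
  have "(B ^\<^sub>m Suc k) $$ (i, j) = (\<Sum>l<n. (B ^\<^sub>m k) $$ (i, l) * B $$ (l, j))"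
    using B Suc.prems pow_carrier_mat[OF B, of k]
    by (simp add: scalar_prod_def atLeast0LessThan)
  also have "\<dots> = (\<Sum>l<n. if l = i then B $$ (i, i) ^ k * B $$ (i, j) else 0)"
  proof (intro sum.cong refl)
    fix l assume "l \<in> {..<n}"
    then show "(B ^\<^sub>m k) $$ (i, l) * B $$ (l, j) = (if l = i then B $$ (i, i) ^ k * B $$ (i, j) else 0)"
      using Suc.IH[of l i] Suc.prems ut[of j l] by (cases "l \<le> i") auto
  qed
  also have "\<dots> = B $$ (i, i) ^ k * B $$ (i, j)" using Suc.prems by simp
  also have "\<dots> = (if i = j then B $$ (i, i) ^ Suc k else 0)"
    using Suc.prems ut[of j i] by (simp add: mult.commute)
  finally show ?case .
qed

definition one_minus_tM :: "'a::ring_1 mat \<Rightarrow> 'a fps mat" where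
  "one_minus_tM M = mat (dim_row M) (dim_row M)
     (\<lambda>(i, j). (if i = j then 1 else 0) - fps_X * fps_const (M $$ (i, j)))"

lemma one_minus_tM_eq:
  assumes "M \<in> carrier_mat n n"
  shows "one_minus_tM M = 1\<^sub>m n - fps_X \<cdot>\<^sub>m map_mat fps_const M"
  using assms by (intro eq_matI) (auto simp: one_minus_tM_def)

lemma semiring_hom_fps_const: "semiring_hom (fps_const :: 'a::comm_ring_1 \<Rightarrow> _)"
  by unfold_locales simp_all

lemma det_one_minus_tM_nth_0:
  fixes M :: "'a::comm_ring_1 mat"
  assumes M: "M \<in> carrier_mat n n"
  shows "fps_nth (det (one_minus_tM M)) 0 = 1"
proof -
  interpret comm_ring_hom "\<lambda>f :: 'a fps. fps_nth f 0"
    by unfold_locales simp_all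
  have "fps_nth (det (one_minus_tM M)) 0 = det (map_mat (\<lambda>f. fps_nth f 0) (one_minus_tM M))"
    by (simp add: hom_det)
  also have "map_mat (\<lambda>f. fps_nth f 0) (one_minus_tM M) = 1\<^sub>m n"
    using M by (intro eq_matI) (auto simp: one_minus_tM_def)
  finally show ?thesis by simp
qed

text \<open>Schur triangularisation reduces this to linear factors: similarity preserves the
  determinant and the traces of powers, and each diagonal entry \<open>b\<close> of the triangular
  form contributes the geometric series of \<open>1 - b t\<close>.\<close>

lemma has_log_deriv_det:
  assumes M: "M \<in> carrier_mat n n"
  shows "has_log_deriv (det (one_minus_tM M))
     (- Abs_fps (\<lambda>k. if 0 < k then trace (M ^\<^sub>m k) else 0))"
proof -
  interpret c: semiring_hom "fps_const :: complex \<Rightarrow> _" by (rule semiring_hom_fps_const)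
  from char_poly_factorized[OF M] schur_decomposition_exists[OF M]
  obtain B where B: "B \<in> carrier_mat n n" and ut: "upper_triangular B" and "similar_mat M B"
    by blast
  then obtain P Q where PQ: "similar_mat_wit M B P Q" by (auto simp: similar_mat_def)
  note w = similar_mat_witD2[OF M PQ]
  have ut': "B $$ (i, j) = 0" if "j < i" "i < n" for i j
    using ut that B by (auto simp: upper_triangular_def)
  let ?c = "map_mat fps_const :: complex mat \<Rightarrow> _"
  have cM: "?c M = ?c P * ?c B * ?c Q"
    using w by (metis c.mat_hom_mult mult_carrier_mat)
  have c1: "?c P * ?c Q = 1\<^sub>m n"
    using w by (metis c.mat_hom_mult c.mat_hom_one)
  have c2: "?c Q * ?c P = 1\<^sub>m n"
    using w by (metis c.mat_hom_mult c.mat_hom_one)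
  have carr: "?c P \<in> carrier_mat n n" "?c B \<in> carrier_mat n n" "?c Q \<in> carrier_mat n n"
    using w by auto
  \<comment> \<open>The conjugating matrices become constant series and \<open>t\<close> is central,
    so the similarity carries over from \<open>M\<close> to \<open>I - tM\<close>.\<close>
  have "similar_mat_wit (one_minus_tM M) (one_minus_tM B) (?c P) (?c Q)"
  proof -
    have "?c P * (1\<^sub>m n - fps_X \<cdot>\<^sub>m ?c B) * ?c Q = (?c P - fps_X \<cdot>\<^sub>m (?c P * ?c B)) * ?c Q"
      using carr by (subst mult_minus_distrib_mat[of _ n n])
        (auto simp: mult_smult_distrib[of _ n n])
    also have "\<dots> = 1\<^sub>m n - fps_X \<cdot>\<^sub>m (?c P * ?c B * ?c Q)"
      using carr c1 by (subst minus_mult_distrib_mat[of _ n n]) (auto simp: mult_smult_assoc_mat[of _ n n])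
    finally have "one_minus_tM M = ?c P * one_minus_tM B * ?c Q"
      by (simp add: one_minus_tM_eq[OF M] one_minus_tM_eq[OF B] cM)
    moreover have "one_minus_tM M \<in> carrier_mat n n" "one_minus_tM B \<in> carrier_mat n n"
      using M B by (auto simp: one_minus_tM_def)
    ultimately show ?thesis
      using carr c1 c2 by (simp add: similar_mat_wit_def Let_def)
  qed
  then have "det (one_minus_tM M) = det (one_minus_tM B)"
    by (intro det_similar) (auto simp: similar_mat_def)
  also have "\<dots> = prod_list (diag_mat (one_minus_tM B))"
    using B ut' by (intro det_upper_triangular[where n = n])
      (auto simp: upper_triangular_def one_minus_tM_def)
  also have "\<dots> = (\<Prod>i<n. 1 - fps_const (B $$ (i, i)) * fps_X ^ 1)"
    using B by (simp add: diag_mat_def prod.distinct_set_conv_list[symmetric] atLeast0LessThan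
      one_minus_tM_def mult.commute)
  finally have d: "det (one_minus_tM M) = (\<Prod>i<n. 1 - fps_const (B $$ (i, i)) * fps_X ^ 1)" .
  have "trace (M ^\<^sub>m k) = (\<Sum>i<n. B $$ (i, i) ^ k)" for k
  proof -
    have Bk: "B ^\<^sub>m k \<in> carrier_mat n n" using B by simp
    have "trace (M ^\<^sub>m k) = trace (P * (B ^\<^sub>m k) * Q)"
      by (simp add: similar_mat_wit_pow_id[OF PQ])
    also have "\<dots> = trace (Q * (P * (B ^\<^sub>m k)))"
      using w Bk by (intro trace_commute[of _ n n]) auto
    also have "Q * (P * (B ^\<^sub>m k)) = B ^\<^sub>m k"
      using w Bk by (subst assoc_mult_mat[symmetric, of _ n n _ n _ n]) auto
    finally show ?thesis
      using B upper_triangular_pow[OF B ut'] by (simp add: trace_def)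
  qed
  then have "(\<Sum>i<n. geom_log_deriv 1 (B $$ (i, i)))
      = - Abs_fps (\<lambda>k. if 0 < k then trace (M ^\<^sub>m k) else 0)"
    by (intro fps_ext) (simp add: fps_sum_nth geom_log_deriv_def sum_negf)
  moreover have "has_log_deriv (\<Prod>i<n. 1 - fps_const (B $$ (i, i)) * fps_X ^ 1)
      (\<Sum>i<n. geom_log_deriv 1 (B $$ (i, i)))"
    by (intro has_log_deriv_prod has_log_deriv_linear_factor) simp
  ultimately show ?thesis unfolding d by simp
qed

section \<open>Complex representations of quaternionic matrices\<close>

text \<open>
  The locale assumptions say that \<open>x \<mapsto> [[s x, p' x], [p x, s' x]]\<close> is a ring homomorphism into
  the \<open>2 \<times> 2\<close> matrices; on matrices the four entries are collected into blocks.
\<close>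

locale matrix_rep =
  fixes s p' p s' :: "'a::ring_1 \<Rightarrow> 'b::comm_ring_1"
  assumes s_diff: "s (x - y) = s x - s y" and p'_diff: "p' (x - y) = p' x - p' y"
    and p_diff: "p (x - y) = p x - p y" and s'_diff: "s' (x - y) = s' x - s' y"
    and s_one: "s 1 = 1" and p'_one: "p' 1 = 0" and p_one: "p 1 = 0" and s'_one: "s' 1 = 1"
    and s_mult: "s (x * y) = s x * s y + p' x * p y"
    and p'_mult: "p' (x * y) = s x * p' y + p' x * s' y"
    and p_mult: "p (x * y) = p x * s y + s' x * p y"
    and s'_mult: "s' (x * y) = p x * p' y + s' x * s' y"
begin

definition rep :: "'a mat \<Rightarrow> 'b mat" where
  "rep M = four_block_mat (map_mat s M) (map_mat p' M) (map_mat p M) (map_mat s' M)"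

lemma zero: "s 0 = 0" "p' 0 = 0" "p 0 = 0" "s' 0 = 0"
  using s_diff[of 0 0] p'_diff[of 0 0] p_diff[of 0 0] s'_diff[of 0 0] by simp_all

lemma rep_carrier: "M \<in> carrier_mat n k \<Longrightarrow> rep M \<in> carrier_mat (2 * n) (2 * k)"
  by (auto simp: rep_def)

lemma rep_diff:
  assumes "A \<in> carrier_mat n k" "B \<in> carrier_mat n k"
  shows "rep (A - B) = rep A - rep B"
  using assms by (intro eq_matI) (auto simp: rep_def s_diff p'_diff p_diff s'_diff)

lemma rep_one: "rep (1\<^sub>m n) = 1\<^sub>m (2 * n)"
  by (intro eq_matI) (auto simp: rep_def s_one p'_one p_one s'_one zero)

text \<open>Each block of a product is a sum of two products of blocks, so one statement serves all
  four.\<close>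

lemma map_mat_mult_split:
  fixes h f g f' g' :: "'a \<Rightarrow> 'b"
  assumes h: "\<And>x y. h (x - y) = h x - h y" and m: "\<And>x y. h (x * y) = f x * g y + f' x * g' y"
    and A: "A \<in> carrier_mat n k" and B: "B \<in> carrier_mat k l"
  shows "map_mat h (A * B) = map_mat f A * map_mat g B + map_mat f' A * map_mat g' B"
proof -
  have h0: "h 0 = 0" using h[of 0 0] by simp
  have "h (x + y) = h x + h y" for x y
    using h[of "x + y" y] by simp
  then have hs: "h (sum u I) = (\<Sum>i\<in>I. h (u i))" for u :: "nat \<Rightarrow> 'a" and I
    by (induction I rule: infinite_finite_induct) (simp_all add: h0)
  show ?thesis
    using A B by (intro eq_matI) (auto simp: scalar_prod_def hs m sum.distrib)
qed

lemma rep_mult: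
  assumes A: "A \<in> carrier_mat n k" and B: "B \<in> carrier_mat k l"
  shows "rep (A * B) = rep A * rep B"
proof -
  have "rep A * rep B = four_block_mat
      (map_mat s A * map_mat s B + map_mat p' A * map_mat p B)
      (map_mat s A * map_mat p' B + map_mat p' A * map_mat s' B)
      (map_mat p A * map_mat s B + map_mat s' A * map_mat p B)
      (map_mat p A * map_mat p' B + map_mat s' A * map_mat s' B)"
    using A B unfolding rep_def by (intro mult_four_block_mat[of _ n k]) auto
  also have "\<dots> = rep (A * B)"
    unfolding rep_def
    using map_mat_mult_split[OF s_diff s_mult A B] map_mat_mult_split[OF p'_diff p'_mult A B]
      map_mat_mult_split[OF p_diff p_mult A B] map_mat_mult_split[OF s'_diff s'_mult A B]
    by simp
  finally show ?thesis by simp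
qed

lemma rep_pow:
  assumes A: "A \<in> carrier_mat n n"
  shows "rep (A ^\<^sub>m k) = rep A ^\<^sub>m k"
proof (induction k)
  case 0
  then show ?case using A rep_carrier[OF A] by (simp add: rep_one)
next
  case (Suc k)
  then show ?case using rep_mult[OF pow_carrier_mat[OF A, of k] A] by simp
qed

end

abbreviation (input) neg_cnj_perplex :: "quat \<Rightarrow> complex" where
  "neg_cnj_perplex x \<equiv> - cnj (perplex_part x)"

abbreviation (input) cnj_simplex :: "quat \<Rightarrow> complex" where
  "cnj_simplex x \<equiv> cnj (simplex_part x)"

lemma simplex_perplex_diff:
  "simplex_part (x - y) = simplex_part x - simplex_part y"
  "perplex_part (x - y) = perplex_part x - perplex_part y"
  by (simp_all add: complex_eq_iff simplex_part_def perplex_part_def)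

lemma simplex_perplex_const [simp]:
  "simplex_part 0 = 0" "perplex_part 0 = 0" "simplex_part 1 = 1" "perplex_part 1 = 0"
  by (simp_all add: complex_eq_iff simplex_part_def perplex_part_def)

text \<open>For \<open>x = s + j p\<close> the product rules express \<open>z j = j cnj z\<close>,
  for complex \<open>z\<close>, and \<open>j^2 = -1\<close>.\<close>

interpretation psi: matrix_rep simplex_part neg_cnj_perplex perplex_part cnj_simplex
  rewrites "matrix_rep.rep simplex_part neg_cnj_perplex perplex_part cnj_simplex = psi"
proof -
  show r: "matrix_rep simplex_part neg_cnj_perplex perplex_part cnj_simplex"
    by unfold_locales
      (simp_all add: complex_eq_iff simplex_part_def perplex_part_def algebra_simps)
  show "matrix_rep.rep simplex_part neg_cnj_perplex perplex_part cnj_simplex = psi"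
    by (intro ext) (simp add: matrix_rep.rep_def[OF r] psi_def)
qed

section \<open>Extending the representation to power series coefficient by coefficient\<close>

definition fps_map :: "('a \<Rightarrow> 'b) \<Rightarrow> 'a fps \<Rightarrow> 'b fps" where
  "fps_map h f = Abs_fps (\<lambda>k. h (fps_nth f k))"

lemma fps_map_nth [simp]: "fps_nth (fps_map h f) k = h (fps_nth f k)"
  by (simp add: fps_map_def)

lemma fps_map_diff:
  "(\<And>x y. h (x - y) = h x - h y) \<Longrightarrow> fps_map h (f - g) = fps_map h f - fps_map h g"
  by (rule fps_ext) simp

lemma fps_map_one: "h 0 = 0 \<Longrightarrow> fps_map h 1 = fps_const (h 1)"
  by (rule fps_ext) simp

lemma fps_map_mult:
  fixes h a b c d :: "'a::ring_1 \<Rightarrow> 'b::comm_ring_1"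
  assumes h: "\<And>x y. h (x - y) = h x - h y" and m: "\<And>x y. h (x * y) = a x * b y + c x * d y"
  shows "fps_map h (f * g) = fps_map a f * fps_map b g + fps_map c f * fps_map d g"
proof -
  have h0: "h 0 = 0" using h[of 0 0] by simp
  have "h (x + y) = h x + h y" for x y
    using h[of "x + y" y] by simp
  then have "h (sum u I) = (\<Sum>i\<in>I. h (u i))" for u :: "nat \<Rightarrow> 'a" and I
    by (induction I rule: infinite_finite_induct) (simp_all add: h0)
  then show ?thesis
    by (intro fps_ext) (simp add: fps_mult_nth m sum.distrib)
qed

interpretation psi_t: matrix_rep "fps_map simplex_part" "fps_map neg_cnj_perplex"
    "fps_map perplex_part" "fps_map cnj_simplex"
  rewrites "matrix_rep.rep (fps_map simplex_part) (fps_map neg_cnj_perplex)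
    (fps_map perplex_part) (fps_map cnj_simplex) = psi_t"
proof -
  show r: "matrix_rep (fps_map simplex_part) (fps_map neg_cnj_perplex)
      (fps_map perplex_part) (fps_map cnj_simplex)"
    by unfold_locales
      (intro fps_map_diff fps_map_mult psi.s_diff psi.p'_diff psi.p_diff psi.s'_diff
        psi.s_mult psi.p'_mult psi.p_mult psi.s'_mult | simp add: fps_map_one)+
  show "matrix_rep.rep (fps_map simplex_part) (fps_map neg_cnj_perplex)
      (fps_map perplex_part) (fps_map cnj_simplex) = psi_t"
  proof (intro ext eq_matI)
    fix M :: "quat fps mat" and i j
    assume "i < dim_row (psi_t M)" "j < dim_col (psi_t M)"
    then show "matrix_rep.rep (fps_map simplex_part) (fps_map neg_cnj_perplex)
      (fps_map perplex_part) (fps_map cnj_simplex) M $$ (i, j) = psi_t M $$ (i, j)"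
      by (intro fps_ext) (auto simp: matrix_rep.rep_def[OF r] psi_t_def psi_def)
  qed (simp_all add: matrix_rep.rep_def[OF r] psi_t_def)
qed

lemma psi_t_one_minus_tM:
  assumes M: "M \<in> carrier_mat n n"
  shows "psi_t (one_minus_tM M) = one_minus_tM (psi M)"
proof -
  have "fps_map h ((if c then 1 else 0) - fps_X * fps_const x)
      = (if c then fps_const (h 1) else 0) - fps_X * fps_const (h x)"
    if "\<And>x y. h (x - y) = h x - h y" for h :: "quat \<Rightarrow> complex" and c x
  proof -
    have "h 0 = 0" using that[of 0 0] by simp
    then show ?thesis by (intro fps_ext) (auto simp: that)
  qed
  note * = this[of simplex_part] this[of perplex_part] this[of neg_cnj_perplex] this[of cnj_simplex]
  show ?thesis
    using M by (intro eq_matI)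
      (auto simp: psi_t.rep_def psi.rep_def one_minus_tM_def * simplex_perplex_diff)
qed

lemma Q0_sum: "Q0 (sum f A) = (\<Sum>x\<in>A. Q0 (f x))"
  by (induction A rule: infinite_finite_induct) simp_all

text \<open>The diagonal of \<open>psi A\<close> consists of the simplex parts of the diagonal of
  \<open>A\<close> and their conjugates; each pair adds up to twice a real part.\<close>

lemma trace_psi:
  assumes "A \<in> carrier_mat n n"
  shows "trace (psi A) = of_real (2 * Q0 (trace A))"
proof -
  have "of_real (2 * Q0 (trace A)) = (\<Sum>i<n. of_real (2 * Q0 (A $$ (i, i))))"
    using assms by (simp add: trace_def sum_distrib_left Q0_sum)
  also have "\<dots> = (\<Sum>i<n. psi A $$ (i, i)) + (\<Sum>i<n. psi A $$ (i + n, i + n))"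
    unfolding sum.distrib[symmetric] using assms
    by (intro sum.cong) (auto simp: psi.rep_def simplex_part_def complex_eq_iff)
  also have "(\<Sum>i<n. psi A $$ (i + n, i + n)) = (\<Sum>i\<in>{n..<n + n}. psi A $$ (i, i))"
    using sum.shift_bounds_nat_ivl[of "\<lambda>i. psi A $$ (i, i)" 0 n n]
    by (simp add: atLeast0LessThan)
  also have "(\<Sum>i<n. psi A $$ (i, i)) + \<dots> = trace (psi A)"
    using psi.rep_carrier[OF assms] sum.atLeastLessThan_concat[of 0 n "n + n" "\<lambda>i. psi A $$ (i, i)"]
    by (simp add: trace_def atLeast0LessThan mult_2)
  finally show ?thesis by simp
qed

lemma has_log_deriv_det_psi:
  assumes M: "M \<in> carrier_mat n n"
  shows "has_log_deriv (Sdet_t (one_minus_tM M))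
    (- Abs_fps (\<lambda>k. if 0 < k then of_real (2 * Q0 (trace (M ^\<^sub>m k))) else 0))"
proof -
  have "trace (psi M ^\<^sub>m k) = of_real (2 * Q0 (trace (M ^\<^sub>m k)))" for k
    by (simp only: psi.rep_pow[OF M, symmetric] trace_psi[OF pow_carrier_mat[OF M]])
  with has_log_deriv_det[OF psi.rep_carrier[OF M]] show ?thesis
    by (simp only: Sdet_t_def psi_t_one_minus_tM[OF M])
qed

lemma Sdet_t_one_minus_tM_nth_0:
  assumes M: "M \<in> carrier_mat n n"
  shows "fps_nth (Sdet_t (one_minus_tM M)) 0 = 1"
  using det_one_minus_tM_nth_0[OF psi.rep_carrier[OF M]]
  by (simp add: Sdet_t_def psi_t_one_minus_tM[OF M])

section \<open>Cyclic words and Lyndon words\<close>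

text \<open>Here \<open>a x y\<close> is the weight of the transition from letter \<open>x\<close>
  to letter \<open>y\<close>. The argument \<open>j\<close> is the letter after the last one, so
  that walks can be concatenated and closed up.\<close>

primrec path_prod :: "('b \<Rightarrow> 'b \<Rightarrow> 'a::monoid_mult) \<Rightarrow> 'b list \<Rightarrow> 'b \<Rightarrow> 'a" where
  "path_prod a [] j = 1"
| "path_prod a (x # xs) j = a x (hd (xs @ [j])) * path_prod a xs j"

definition cyc_prod :: "('b \<Rightarrow> 'b \<Rightarrow> 'a::monoid_mult) \<Rightarrow> 'b list \<Rightarrow> 'a" where
  "cyc_prod a x = path_prod a x (hd x)"

lemma path_prod_append:
  "path_prod a (xs @ ys) j = path_prod a xs (hd (ys @ [j])) * path_prod a ys j"
proof (induction xs)
  case (Cons x xs)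
  then show ?case by (cases xs) (simp_all add: mult.assoc)
qed simp

lemma Q0_mult_commute: "Q0 (x * y) = Q0 (y * x)"
  by simp

text \<open>Rotation by one letter moves the first factor to the end. The product itself may change,
  but the real part of \<open>x y\<close> equals that of \<open>y x\<close>.\<close>

lemma Q0_cyc_prod_rotate: "Q0 (cyc_prod a (rotate k x)) = Q0 (cyc_prod a x)"
proof (induction k)
  case (Suc k)
  have "Q0 (cyc_prod a (rotate1 y)) = Q0 (cyc_prod a y)" for y
  proof (cases y)
    case (Cons b ys)
    have "cyc_prod a (rotate1 y) = path_prod a ys b * a b (hd (ys @ [b]))"
      by (simp add: Cons cyc_prod_def path_prod_append)
    moreover have "cyc_prod a y = a b (hd (ys @ [b])) * path_prod a ys b"
      by (simp add: Cons cyc_prod_def)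
    ultimately show ?thesis by (metis Q0_mult_commute)
  qed simp
  with Suc show ?case by simp
qed simp

lemma cyc_prod_concat_replicate: "cyc_prod a (concat (replicate r p)) = cyc_prod a p ^ r"
proof (cases "p = []")
  case True
  then have "concat (replicate r p) = []" by simp
  with True show ?thesis by (simp add: cyc_prod_def)
next
  case False
  have h: "hd (concat (replicate r p) @ [hd p]) = hd p" for r
    using False by (cases r) simp_all
  have "path_prod a (concat (replicate r p)) (hd p) = path_prod a p (hd p) ^ r"
    by (induction r) (simp_all add: path_prod_append h)
  moreover have "cyc_prod a (concat (replicate r p)) = path_prod a (concat (replicate r p)) (hd p)"
    using False by (cases r) (simp_all add: cyc_prod_def)
  ultimately show ?thesis by (simp add: cyc_prod_def)
qed

section \<open>Traces of matrix powers as sums over words\<close>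

definition words :: "'b set \<Rightarrow> nat \<Rightarrow> 'b list set" where
  "words A k = {x. set x \<subseteq> A \<and> length x = k}"

lemma finite_words: "finite A \<Longrightarrow> finite (words A k)"
  unfolding words_def by (rule finite_lists_length_eq)

text \<open>The power \<open>Suc k\<close> passes through \<open>k\<close> intermediate indices.
  Matrix indices start at 0 and letters at 1, whence the shifts.\<close>

lemma pow_mat_entry:
  fixes a :: "nat \<Rightarrow> nat \<Rightarrow> 'a::ring_1" and N :: nat
  defines "M \<equiv> mat N N (\<lambda>(i, j). a (Suc i) (Suc j))"
  assumes "i < N" "j < N"
  shows "(M ^\<^sub>m Suc k) $$ (i, j) = (\<Sum>xs\<in>words {1..N} k. path_prod a (Suc i # xs) (Suc j))"
  using \<open>j < N\<close>
proof (induction k arbitrary: j)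
  case 0
  have "words {1..N} 0 = {[]}" by (auto simp: words_def)
  then show ?case using 0 \<open>i < N\<close> by (simp add: M_def)
next
  case (Suc k)
  have M: "M \<in> carrier_mat N N" by (simp add: M_def)
  have Mk: "M ^\<^sub>m Suc k \<in> carrier_mat N N" using M by (rule pow_carrier_mat)
  have "(M ^\<^sub>m Suc (Suc k)) $$ (i, j) = (\<Sum>l<N. (M ^\<^sub>m Suc k) $$ (i, l) * M $$ (l, j))"
    using M Mk \<open>i < N\<close> Suc.prems
    by (subst pow_mat.simps(2)) (simp add: scalar_prod_def atLeast0LessThan del: pow_mat.simps)
  also have "\<dots> = (\<Sum>l<N. \<Sum>xs\<in>words {1..N} k. path_prod a (Suc i # xs) (Suc l) * a (Suc l) (Suc j))"
    using Suc by (intro sum.cong) (simp_all add: M_def sum_distrib_right del: pow_mat.simps)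
  also have "\<dots> = (\<Sum>(l, xs)\<in>{..<N} \<times> words {1..N} k.
      path_prod a (Suc i # xs) (Suc l) * a (Suc l) (Suc j))"
    by (simp add: sum.cartesian_product)
  also have "\<dots> = (\<Sum>xs\<in>words {1..N} (Suc k). path_prod a (Suc i # xs) (Suc j))"
  proof (rule sum.reindex_bij_witness[where i = "\<lambda>xs. (last xs - 1, butlast xs)"
        and j = "\<lambda>(l, xs). xs @ [Suc l]"])
    fix xs assume xs: "xs \<in> words {1..N} (Suc k)"
    then have "xs \<noteq> []" by (auto simp: words_def)
    then have "last xs \<in> set xs" by simp
    then have "last xs \<in> {1..N}" using xs unfolding words_def by blast
    then have l: "Suc (last xs - 1) = last xs" "last xs - 1 < N" by auto
    show "(case (last xs - 1, butlast xs) of (l, xs) \<Rightarrow> xs @ [Suc l]) = xs"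
      using l \<open>xs \<noteq> []\<close> by simp
    show "(last xs - 1, butlast xs) \<in> {..<N} \<times> words {1..N} k"
      using xs l by (auto simp: words_def dest: in_set_butlastD)
  next
    fix z assume z: "z \<in> {..<N} \<times> words {1..N} k"
    then obtain l xs where [simp]: "z = (l, xs)" by (cases z)
    show "path_prod a (Suc i # (case z of (l, xs) \<Rightarrow> xs @ [Suc l])) (Suc j)
        = (case z of (l, xs) \<Rightarrow> path_prod a (Suc i # xs) (Suc l) * a (Suc l) (Suc j))"
      using path_prod_append[of a "Suc i # xs" "[Suc l]" "Suc j"] by simp
  qed (auto simp: words_def)
  finally show ?case .
qed

text \<open>The diagonal sum supplies the first letter and closes the walk. For \<open>k = 0\<close>
  the trace is \<open>N\<close>, whereas the empty word alone gives 1.\<close>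

lemma trace_pow_mat:
  fixes a :: "nat \<Rightarrow> nat \<Rightarrow> 'a::ring_1"
  assumes "0 < k"
  shows "trace (mat N N (\<lambda>(i, j). a (Suc i) (Suc j)) ^\<^sub>m k) = (\<Sum>x\<in>words {1..N} k. cyc_prod a x)"
proof -
  obtain k' where k: "k = Suc k'" using assms by (cases k) auto
  let ?M = "mat N N (\<lambda>(i, j). a (Suc i) (Suc j))"
  have "trace (?M ^\<^sub>m k) = (\<Sum>i<N. \<Sum>xs\<in>words {1..N} k'. path_prod a (Suc i # xs) (Suc i))"
    unfolding trace_def k by (intro sum.cong) (simp_all add: pow_mat_entry del: pow_mat.simps)
  also have "\<dots> = (\<Sum>(i, xs)\<in>{..<N} \<times> words {1..N} k'. cyc_prod a (Suc i # xs))"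
    by (simp add: sum.cartesian_product cyc_prod_def)
  also have "\<dots> = (\<Sum>x\<in>words {1..N} k. cyc_prod a x)"
  proof (rule sum.reindex_bij_witness[where i = "\<lambda>xs. (hd xs - 1, tl xs)"
        and j = "\<lambda>(l, xs). Suc l # xs"])
    fix xs assume xs: "xs \<in> words {1..N} k"
    then obtain y ys where "xs = y # ys" by (cases xs) (auto simp: words_def k)
    then show "(case (hd xs - 1, tl xs) of (l, xs) \<Rightarrow> Suc l # xs) = xs"
      "(hd xs - 1, tl xs) \<in> {..<N} \<times> words {1..N} k'"
      using xs by (auto simp: words_def k)
  qed (auto simp: words_def k)
  finally show ?thesis .
qed

section \<open>Lyndon words and rotation classes\<close>

lemma lyndon_words_iff:
  "x \<in> lyndon_words A \<longleftrightarrow>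
     x \<noteq> [] \<and> set x \<subseteq> A \<and> (\<forall>k. 0 < k \<and> k < length x \<longrightarrow> x < rotate k x)"
  by (simp add: lyndon_words_def list_less_def)

text \<open>Words of equal length are never proper prefixes of each other, so the first block
  already decides.\<close>

lemma concat_replicate_less:
  fixes u v :: "'b::linorder list"
  assumes "u < v" "length u = length v" "0 < r"
  shows "concat (replicate r u) < concat (replicate r v)"
proof -
  obtain r' where "r = Suc r'" using assms by (cases r) auto
  then show ?thesis
    using assms lexord_sufI[of u v] by (simp add: list_less_def)
qed

lemma rotate_concat_replicate:
  "rotate k (concat (replicate r p)) = concat (replicate r (rotate k p))"
proof (induction k)
  case (Suc k)
  have "rotate1 (concat (replicate r q)) = concat (replicate r (rotate1 q))" for q :: "'b list"
  proof (cases q)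
    case (Cons b qs)
    have *: "concat (replicate n (b # qs)) @ [b] = b # concat (replicate n (qs @ [b]))" for n
      by (induction n) simp_all
    show ?thesis
    proof (cases r)
      case (Suc n)
      show ?thesis using *[of n] by (simp add: Cons Suc)
    qed simp
  qed simp
  with Suc show ?case by simp
qed simp

lemma length_concat_replicate: "length (concat (replicate r p)) = r * length p"
  by (induction r) simp_all

text \<open>Commutation makes \<open>p\<close> a prefix of \<open>z\<close> while \<open>z\<close>
  is long enough; cancelling it leaves a shorter word that still commutes with
  \<open>p\<close>.\<close>

lemma commuting_word_power:
  "z @ p = p @ z \<Longrightarrow> length z = c * length p \<Longrightarrow> z = concat (replicate c p)"
proof (induction c arbitrary: z)
  case (Suc c)
  have "p = take (length p) z"
    using Suc.prems by (metis append_eq_conv_conj le_add1 mult_Suc take_append append_Nil2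
      diff_is_0_eq take_0)
  then obtain z' where z': "z = p @ z'" by (metis append_take_drop_id)
  with Suc.prems have "z' @ p = p @ z'" "length z' = c * length p" by auto
  then show ?case using Suc.IH z' by simp
qed simp

text \<open>Rotating the power by \<open>k\<close> rotates each block by
  \<open>k mod length p\<close>, and a nontrivial rotation of a Lyndon word is strictly larger. So
  the power is least in its rotation class and has exact period \<open>length p\<close>, two facts
  that recover \<open>p\<close> from the class.\<close>

lemma lyndon_power_rotate:
  assumes p: "p \<in> lyndon_words A" and r: "0 < r"
  defines "y \<equiv> concat (replicate r p)"
  shows "y \<le> rotate k y" and "rotate k y = y \<longleftrightarrow> length p dvd k"
proof -
  have e: "rotate k y = concat (replicate r (rotate (k mod length p) p))"
    unfolding y_def rotate_concat_replicate by (metis rotate_conv_mod)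
  have "y < rotate k y" if "\<not> length p dvd k"
    unfolding e unfolding y_def
  proof (rule concat_replicate_less)
    show "p < rotate (k mod length p) p"
      using p that by (auto simp: lyndon_words_iff dvd_eq_mod_eq_0)
  qed (simp_all add: r)
  moreover have "rotate k y = y" if "length p dvd k"
    unfolding e using that by (simp add: y_def dvd_eq_mod_eq_0)
  ultimately show "y \<le> rotate k y" "rotate k y = y \<longleftrightarrow> length p dvd k"
    by (cases "length p dvd k"; simp)+
qed

lemma rotate_full: "length x dvd k \<Longrightarrow> rotate k x = x"
  by (subst rotate_conv_mod) (simp add: dvd_eq_mod_eq_0)

text \<open>The number \<open>K * i - i\<close> represents \<open>- i\<close> modulo the word length
  \<open>K\<close>, since rotations take natural numbers.\<close>

lemma rotate_back:
  assumes "rotate i y = rotate j z" "length y = K" "0 < K"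
  shows "rotate (K * i - i + j) z = y"
proof -
  have "rotate (K * i - i + j) z = rotate (K * i - i) (rotate i y)"
    unfolding assms(1) by (simp only: rotate_rotate)
  also have "\<dots> = rotate (K * i) y"
  proof -
    have "K * i - i + i = K * i" using \<open>0 < K\<close> by (cases K) simp_all
    then show ?thesis by (simp only: rotate_rotate)
  qed
  also have "\<dots> = y" using assms by (simp add: rotate_full)
  finally show ?thesis .
qed

text \<open>Uniqueness: the power is the least element of the rotation class and
  \<open>length p\<close> its exact period, so the word determines both, and offsets below the
  period give distinct rotations. Existence: the least rotation, cut at its least period, starts
  with the required Lyndon word.\<close>

lemma bij_betw_lyndon_rotations:
  assumes K: "0 < K"
  shows "bij_betw (\<lambda>(p, i). rotate i (concat (replicate (K div length p) p)))
    (SIGMA p:{p \<in> lyndon_words A. length p dvd K}. {..<length p}) (words A K)"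
    (is "bij_betw ?f ?D _")
proof (rule bij_betwI')
  have D: "p \<in> lyndon_words A" "0 < K div length p" "i < length p" "length p dvd K"
      "length (concat (replicate (K div length p) p)) = K"
      "take (length p) (concat (replicate (K div length p) p)) = p"
    if "(p, i) \<in> ?D" for p i
  proof -
    show *: "p \<in> lyndon_words A" "i < length p" "length p dvd K" using that by auto
    then show "0 < K div length p" using K
      by (auto simp: div_greater_zero_iff lyndon_words_iff intro!: dvd_imp_le)
    then show "take (length p) (concat (replicate (K div length p) p)) = p"
      by (cases "K div length p") simp_all
    show "length (concat (replicate (K div length p) p)) = K"
      using * by (simp only: length_concat_replicate dvd_div_mult_self)
  qed
  fix u v assume uv: "u \<in> ?D" "v \<in> ?D"
  obtain p i q j where u: "u = (p, i)" and v: "v = (q, j)" by (cases u, cases v)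
  note Du = D[OF uv(1)[unfolded u]] and Dv = D[OF uv(2)[unfolded v]]
  show "?f u = ?f v \<longleftrightarrow> u = v"
  proof
    assume eq: "?f u = ?f v"
    define y where "y = concat (replicate (K div length p) p)"
    define z where "z = concat (replicate (K div length q) q)"
    have r: "rotate i y = rotate j z" using eq by (simp add: u v y_def z_def)
    have ly: "length y = K" "length z = K" unfolding y_def z_def by (rule Du, rule Dv)
    have Y: "y \<le> rotate k y" "rotate k y = y \<longleftrightarrow> length p dvd k"
      and Z: "z \<le> rotate k z" "rotate k z = z \<longleftrightarrow> length q dvd k" for k
      using lyndon_power_rotate[OF Du(1,2), of k] lyndon_power_rotate[OF Dv(1,2), of k]
      unfolding y_def z_def by blast+
    \<comment> \<open>Both words are rotations of each other and each is least among its
      rotations.\<close>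
    have "z \<le> y" using Z(1)[of "K * i - i + j"] unfolding rotate_back[OF r ly(1) K] .
    moreover have "y \<le> z"
      using Y(1)[of "K * j - j + i"] unfolding rotate_back[OF r[symmetric] ly(2) K] .
    ultimately have yz: "y = z" by (rule order_antisym[rotated])
    have "length p dvd length q"
      by (rule iffD1[OF Y(2)]) (simp only: yz Z(2) dvd_refl)
    moreover have "length q dvd length p"
      by (rule iffD1[OF Z(2)]) (simp only: yz[symmetric] Y(2) dvd_refl)
    ultimately have pq_length: "length p = length q" by (rule dvd_antisym)
    have "take (length p) y = p" "take (length q) z = q"
      unfolding y_def z_def by (rule Du, rule Dv)
    then have pq: "p = q" unfolding yz pq_length by (rule trans[OF sym])
    note dvd = Du(4)
    \<comment> \<open>Otherwise the positive difference of the offsets would be a period smaller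
      than \<open>length p\<close>.\<close>
    have *: "\<not> i' < j'" if "rotate i' y = rotate j' y" "j' < length p" for i' j'
    proof
      assume "i' < j'"
      have "rotate (K * i' - i' + j') y = y" by (rule rotate_back[OF that(1) ly(1) K])
      moreover have "K * i' - i' + j' = K * i' + (j' - i')"
        using \<open>i' < j'\<close> K by (cases K) simp_all
      ultimately have "length p dvd K * i' + (j' - i')" by (simp only: Y(2))
      then have "length p dvd j' - i'" using dvd by (simp only: dvd_add_right_iff dvd_mult2)
      then show False using \<open>i' < j'\<close> that(2) by (auto dest: dvd_imp_le)
    qed
    have "\<not> i < j" using * r Dv(3) unfolding yz pq_length by blast
    moreover have "\<not> j < i" using * r[symmetric] Du(3) unfolding yz by blast
    ultimately have "i = j" by simp
    with pq show "u = v" by (simp add: u v)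
  qed simp
next
  fix u assume "u \<in> ?D"
  then show "?f u \<in> words A K"
    using K by (cases u) (auto simp: words_def lyndon_words_iff length_concat_replicate)
next
  fix x assume x: "x \<in> words A K"
  then have lx: "length x = K" by (simp add: words_def)
  define R where "R = (\<lambda>k. rotate k x) ` {..<K}"
  define y where "y = Min R"
  have R: "finite R" "R \<noteq> {}" using K by (auto simp: R_def)
  have inR: "rotate k x \<in> R" for k
  proof -
    have "rotate k x = rotate (k mod K) x" using lx rotate_conv_mod by metis
    then show ?thesis using K by (auto simp: R_def)
  qed
  obtain k0 where k0: "y = rotate k0 x" using Min_in[OF R] by (auto simp: y_def R_def)
  have ymin: "y \<le> rotate k y" for k
    unfolding k0 rotate_rotate unfolding k0[symmetric] y_def using R inR by simp
  have ly: "length y = K" using lx k0 by simp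
  txt \<open>The word \<open>y\<close> is a power of its prefix of length \<open>d\<close>, and that prefix is Lyndon.\<close>
  define d where "d = (LEAST d. 0 < d \<and> rotate d y = y)"
  have "0 < K \<and> rotate K y = y" using K ly by (simp add: rotate_full)
  then have d: "0 < d" "rotate d y = y" and dleast: "\<And>k. 0 < k \<Longrightarrow> rotate k y = y \<Longrightarrow> d \<le> k"
    unfolding d_def by (metis (mono_tags, lifting) LeastI, metis (mono_tags, lifting) LeastI,
      metis (mono_tags, lifting) Least_le)
  have dmult: "rotate (d * c) y = y" for c
    by (induction c) (simp_all add: d(2) rotate_rotate[symmetric] add.commute)
  have dmod: "rotate k y = rotate (k mod d) y" for k
  proof -
    have "rotate k y = rotate (k mod d) (rotate (d * (k div d)) y)"
      by (simp add: rotate_rotate)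
    then show ?thesis by (simp add: dmult)
  qed
  \<comment> \<open>Otherwise the remainder would be a positive period below the least one.\<close>
  have "K mod d = 0"
  proof (rule ccontr)
    assume "K mod d \<noteq> 0"
    moreover have "rotate (K mod d) y = y" using dmod[of K] ly by (simp add: rotate_full)
    ultimately have "d \<le> K mod d" by (intro dleast) auto
    then show False using d(1) by (metis leD mod_less_divisor)
  qed
  then obtain c where c: "K = d * c" by auto
  have "d \<le> K" using K c by (cases c) auto
  define p where "p = take d y"
  define z where "z = drop d y"
  have lp: "length p = d" using \<open>d \<le> K\<close> ly by (simp add: p_def)
  have c0: "0 < c" using K c by (cases c) auto
  have y: "y = p @ z" by (simp add: p_def z_def)
  \<comment> \<open>Rotation by \<open>d\<close> exchanges the prefix \<open>p\<close> with the rest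
    \<open>z\<close>; invariance under it says that they commute.\<close>
  have "rotate d y = z @ p" using lp rotate_append[of p z] y by simp
  with d(2) y have "z @ p = p @ z" by simp
  moreover have "length z = (c - 1) * length p"
    using ly c lp by (cases c) (simp_all add: z_def)
  ultimately have "z = concat (replicate (c - 1) p)" by (rule commuting_word_power)
  then have yp: "y = concat (replicate c p)" using y c0 by (cases c) simp_all
  have "p \<in> lyndon_words A"
    unfolding lyndon_words_iff
  proof (intro conjI allI impI)
    show "p \<noteq> []" using lp d(1) by auto
    have "set y \<subseteq> A" using x k0 by (simp add: words_def)
    then show "set p \<subseteq> A" unfolding p_def using set_take_subset by (rule order_trans[rotated])
    fix k assume k: "0 < k \<and> k < length p"
    have rk: "rotate k y = concat (replicate c (rotate k p))"
      by (simp add: yp rotate_concat_replicate)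
    have "rotate k y \<noteq> y" using dleast[of k] k lp by auto
    then have "p \<noteq> rotate k p" using rk yp by auto
    \<comment> \<open>A smaller rotation of \<open>p\<close> would give, block by block, a rotation
      of \<open>y\<close> below the minimum.\<close>
    moreover have "\<not> rotate k p < p"
    proof
      assume "rotate k p < p"
      then have "rotate k y < y" unfolding rk using c0 yp by (simp add: concat_replicate_less)
      then show False using ymin[of k] by simp
    qed
    ultimately show "p < rotate k p" by (metis linorder_neqE)
  qed
  \<comment> \<open>Undoing the rotation by \<open>k0\<close> leads from \<open>y\<close> to
    \<open>x\<close>; reduction modulo the period \<open>d\<close> brings the offset into the
    admissible range.\<close>
  moreover have "x = rotate ((K * k0 - k0) mod d) y"
  proof -
    have "rotate 0 y = rotate k0 x" using k0 by simp
    then have "rotate (K * k0 - k0 + 0) y = x"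
      using rotate_back[of k0 x 0 y K] lx K by simp
    then show ?thesis using dmod by simp
  qed
  moreover have "K div d = c" using c d(1) by simp
  ultimately have "(p, (K * k0 - k0) mod d) \<in> ?D" "x = ?f (p, (K * k0 - k0) mod d)"
    using lp c d(1) yp by auto
  then show "\<exists>u\<in>?D. x = ?f u" by blast
qed

text \<open>The factor \<open>length p\<close> counts the rotations that belong to one Lyndon word,
  on which \<open>f\<close> is constant.\<close>

lemma sum_words_lyndon:
  fixes f :: "'b::linorder list \<Rightarrow> 'a::semiring_1"
  assumes K: "0 < K" and A: "finite A" and f: "\<And>k x. f (rotate k x) = f x"
  shows "(\<Sum>x\<in>words A K. f x) = (\<Sum>p | p \<in> lyndon_words A \<and> length p dvd K.
    of_nat (length p) * f (concat (replicate (K div length p) p)))"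
proof -
  let ?L = "{p. p \<in> lyndon_words A \<and> length p dvd K}"
  have "?L \<subseteq> (\<Union>k\<le>K. words A k)"
    using K by (auto simp: words_def lyndon_words_iff dest: dvd_imp_le)
  then have fin: "finite ?L" by (rule finite_subset) (auto simp: finite_words A)
  have "(\<Sum>x\<in>words A K. f x) = (\<Sum>(p, i)\<in>Sigma ?L (\<lambda>p. {..<length p}).
      f (rotate i (concat (replicate (K div length p) p))))"
    by (subst sum.reindex_bij_betw[OF bij_betw_lyndon_rotations[OF K], symmetric])
      (simp add: case_prod_beta)
  also have "\<dots> = (\<Sum>p\<in>?L. \<Sum>i<length p. f (concat (replicate (K div length p) p)))"
    unfolding f using fin by (subst sum.Sigma) auto
  finally show ?thesis by simp
qed

text \<open>Logarithmic derivatives are compared up to degree \<open>K\<close>; on the left, the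
  traces become sums over words, grouped by Lyndon words. A word of weight zero has factor 1, and
  one longer than \<open>K\<close> contributes only beyond degree \<open>K\<close>, so
  \<open>X\<close> may leave out both kinds.\<close>

lemma Sdet_t_lyndon_product:
  fixes a :: "nat \<Rightarrow> nat \<Rightarrow> quat" and N :: nat
  defines "M \<equiv> mat N N (\<lambda>(i, j). a (Suc i) (Suc j))"
  assumes X: "X \<subseteq> lyndon_words {1..N}" "finite X"
    and XK: "\<And>p. p \<in> lyndon_words {1..N} \<Longrightarrow> length p \<le> K \<Longrightarrow> cyc_prod a p \<noteq> 0 \<Longrightarrow> p \<in> X"
    and "k \<le> K"
  shows "fps_nth (Sdet_t (one_minus_tM M)) k
    = fps_nth (\<Prod>p\<in>X. norm_factor (length p) (cyc_prod a p)) k"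
proof (rule has_log_deriv_unique[OF _ _ _ _ _ \<open>k \<le> K\<close>])
  have M: "M \<in> carrier_mat N N" by (simp add: M_def)
  have pos: "0 < length p" if "p \<in> X" for p
    using X that by (auto simp: lyndon_words_iff)
  show "has_log_deriv (Sdet_t (one_minus_tM M))
    (- Abs_fps (\<lambda>k. if 0 < k then of_real (2 * Q0 (trace (M ^\<^sub>m k))) else 0))"
    by (rule has_log_deriv_det_psi[OF M])
  show "has_log_deriv (\<Prod>p\<in>X. norm_factor (length p) (cyc_prod a p))
    (\<Sum>p\<in>X. norm_factor_log_deriv (length p) (cyc_prod a p))"
    by (intro has_log_deriv_prod has_log_deriv_norm_factor pos)
  have "fps_nth (\<Prod>p\<in>Y. norm_factor (length p) (cyc_prod a p)) 0 = 1" if "Y \<subseteq> X" for Y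
    using that
    by (induction Y rule: infinite_finite_induct) (auto simp: norm_factor_nth_0[OF pos])
  then show "fps_nth (Sdet_t (one_minus_tM M)) 0
      = fps_nth (\<Prod>p\<in>X. norm_factor (length p) (cyc_prod a p)) 0"
    by (simp add: Sdet_t_one_minus_tM_nth_0[OF M])
  fix k assume k: "k \<le> K"
  show "fps_nth (- Abs_fps (\<lambda>k. if 0 < k then of_real (2 * Q0 (trace (M ^\<^sub>m k))) else 0)) k
      = fps_nth (\<Sum>p\<in>X. norm_factor_log_deriv (length p) (cyc_prod a p)) k"
  proof (cases "k = 0")
    case True
    then show ?thesis by (simp add: fps_sum_nth norm_factor_log_deriv_def)
  next
    case False
    let ?L = "{p. p \<in> lyndon_words {1..N} \<and> length p dvd k}"
    let ?f = "\<lambda>p. of_nat (length p) * Q0 (cyc_prod a p ^ (k div length p))"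
    have "?L \<subseteq> (\<Union>k\<le>K. words {1..N} k)"
      using False k by (auto simp: words_def lyndon_words_iff dest: dvd_imp_le)
    then have fin: "finite ?L" by (rule finite_subset) (auto simp: finite_words)
    have "Q0 (trace (M ^\<^sub>m k)) = (\<Sum>x\<in>words {1..N} k. Q0 (cyc_prod a x))"
      using False by (simp add: M_def trace_pow_mat Q0_sum)
    also have "\<dots> = sum ?f ?L"
      using False by (subst sum_words_lyndon) (simp_all add: Q0_cyc_prod_rotate cyc_prod_concat_replicate)
    also have "\<dots> = sum ?f (X \<inter> ?L)"
    proof (rule sum.mono_neutral_right[OF fin], simp, rule ballI)
      fix p assume "p \<in> ?L - X \<inter> ?L"
      then have p: "p \<in> lyndon_words {1..N}" "length p dvd k" "p \<notin> X" by auto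
      then have le: "length p \<le> k" using False by (auto dest: dvd_imp_le)
      with p XK k have "cyc_prod a p = 0" by fastforce
      \<comment> \<open>A positive exponent matters because \<open>0 ^ 0 = 1\<close>.\<close>
      moreover have "0 < k div length p"
        using le p by (auto simp: lyndon_words_iff div_greater_zero_iff)
      ultimately show "?f p = 0" by (simp add: zero_power)
    qed
    also have "\<dots> = (\<Sum>p\<in>X. if length p dvd k then ?f p else 0)"
      using X by (intro sum.mono_neutral_cong_left) auto
    finally have "complex_of_real (2 * Q0 (trace (M ^\<^sub>m k)))
        = (\<Sum>p\<in>X. of_real (2 * (if length p dvd k then ?f p else 0)))"
      by (simp add: sum_distrib_left)
    also have "\<dots> = (\<Sum>p\<in>X. if length p dvd k
        then of_nat (length p) * of_real (2 * Q0 (cyc_prod a p ^ (k div length p))) else 0)"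
      by (intro sum.cong) auto
    finally show ?thesis
      using False by (simp only: fps_neg_nth fps_nth_Abs_fps fps_sum_nth norm_factor_log_deriv_def
        sum_negf) simp
  qed
qed simp_all

section \<open>Reduction from arcs to vertices\<close>

lemma fps_X_const_mult:
  fixes a b :: "'a::ring_1"
  shows "fps_X * fps_const a * (fps_X * fps_const b) = fps_X ^ 2 * fps_const (a * b)"
  by (rule fps_ext) (simp add: mult.assoc power2_eq_square)

lemma mult_mat_entry:
  assumes "A \<in> carrier_mat n k" "B \<in> carrier_mat k l" "i < n" "j < l"
  shows "(A * B) $$ (i, j) = (\<Sum>h<k. A $$ (i, h) * B $$ (h, j))"
  using assms by (simp add: scalar_prod_def atLeast0LessThan)

text \<open>The block matrix \<open>?C\<close> factors both as \<open>?L * ?U\<close> and as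
  \<open>?V * ?L\<close>, and \<open>?L\<close> has determinant 1, so each side is the determinant
  of \<open>?C\<close>.\<close>

lemma det_one_minus_mult_commute:
  fixes A B :: "'a::idom mat"
  assumes A: "A \<in> carrier_mat n k" and B: "B \<in> carrier_mat k n"
  shows "det (1\<^sub>m n - A * B) = det (1\<^sub>m k - B * A)"
proof -
  let ?C = "four_block_mat (1\<^sub>m n) A B (1\<^sub>m k)"
  let ?U = "four_block_mat (1\<^sub>m n) A (0\<^sub>m k n) (1\<^sub>m k - B * A)"
  let ?L = "four_block_mat (1\<^sub>m n) (0\<^sub>m n k) B (1\<^sub>m k)"
  let ?V = "four_block_mat (1\<^sub>m n - A * B) A (0\<^sub>m k n) (1\<^sub>m k)"
  have AB: "A * B \<in> carrier_mat n n" and BA: "B * A \<in> carrier_mat k k" using A B by auto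
  have c: "?L \<in> carrier_mat (n + k) (n + k)" "?U \<in> carrier_mat (n + k) (n + k)"
    "?V \<in> carrier_mat (n + k) (n + k)"
    using A B AB BA by auto
  have dl: "det ?L = 1"
    using B by (subst det_four_block_mat_upper_right_zero[of _ n _ k]) auto
  have "?L * ?U = four_block_mat (1\<^sub>m n * 1\<^sub>m n + 0\<^sub>m n k * 0\<^sub>m k n)
      (1\<^sub>m n * A + 0\<^sub>m n k * (1\<^sub>m k - B * A)) (B * 1\<^sub>m n + 1\<^sub>m k * 0\<^sub>m k n)
      (B * A + 1\<^sub>m k * (1\<^sub>m k - B * A))"
    using A B by (intro mult_four_block_mat[of _ n n]) auto
  also have "\<dots> = ?C"
    using A B AB BA by (intro cong_four_block_mat) auto
  finally have "det (?L * ?U) = det ?C" by (rule arg_cong)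
  then have "det ?C = det ?L * det ?U" unfolding det_mult[OF c(1,2)] by (rule sym)
  also have "\<dots> = det (1\<^sub>m k - B * A)"
    unfolding dl det_four_block_mat_lower_left_zero[OF one_carrier_mat A refl minus_carrier_mat[OF BA]]
    by simp
  finally have 1: "det ?C = det (1\<^sub>m k - B * A)" .
  have "?V * ?L = four_block_mat ((1\<^sub>m n - A * B) * 1\<^sub>m n + A * B)
      ((1\<^sub>m n - A * B) * 0\<^sub>m n k + A * 1\<^sub>m k) (0\<^sub>m k n * 1\<^sub>m n + 1\<^sub>m k * B)
      (0\<^sub>m k n * 0\<^sub>m n k + 1\<^sub>m k * 1\<^sub>m k)"
    using A B by (intro mult_four_block_mat[of _ n n]) auto
  also have "\<dots> = ?C"
    using A B AB BA by (intro cong_four_block_mat) auto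
  finally have "det (?V * ?L) = det ?C" by (rule arg_cong)
  then have "det ?C = det ?V * det ?L" unfolding det_mult[OF c(3,1)] by (rule sym)
  also have "\<dots> = det (1\<^sub>m n - A * B)"
    unfolding dl det_four_block_mat_lower_left_zero[OF minus_carrier_mat[OF AB] A refl one_carrier_mat]
    by simp
  finally show ?thesis using 1 by simp
qed

text \<open>Since \<open>(x y)^(r+1) = x (y x)^r y\<close>, moving the outer \<open>x\<close> to the
  end gives \<open>(y x)^(r+1)\<close> without changing the real part.\<close>

lemma Q0_mult_power_commute: "Q0 ((x * y) ^ k) = Q0 ((y * x) ^ k)"
proof (cases k)
  case (Suc r)
  have "(x * y) ^ Suc r = x * ((y * x) ^ r * y)"
    by (induction r) (simp_all add: mult.assoc)
  then have "Q0 ((x * y) ^ k) = Q0 (((y * x) ^ r * y) * x)"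
    unfolding Suc by (metis Q0_mult_commute)
  also have "((y * x) ^ r * y) * x = (y * x) ^ k"
    by (simp only: Suc power_Suc2 mult.assoc)
  finally show ?thesis .
qed simp

text \<open>The arcs \<open>i\<close> and \<open>m + i\<close>, for \<open>i < m\<close>, are inverse to each other.\<close>

locale arc_matrices =
  fixes m n :: nat and q :: "nat \<Rightarrow> quat" and src tgt :: "nat \<Rightarrow> nat"
  assumes src_less: "i < 2 * m \<Longrightarrow> src i < n" and tgt_less: "i < 2 * m \<Longrightarrow> tgt i < n"
    and src_rev: "i < m \<Longrightarrow> src (m + i) = tgt i" and tgt_rev: "i < m \<Longrightarrow> tgt (m + i) = src i"
begin

definition flip :: "nat \<Rightarrow> nat" where
  "flip i = (if i < m then m + i else i - m)"

lemma flip_less: "i < 2 * m \<Longrightarrow> flip i < 2 * m"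
  and flip_flip: "i < 2 * m \<Longrightarrow> flip (flip i) = i"
  and flip_neq: "i < 2 * m \<Longrightarrow> flip i \<noteq> i"
  and src_flip: "i < 2 * m \<Longrightarrow> src (flip i) = tgt i"
  and tgt_flip: "i < 2 * m \<Longrightarrow> tgt (flip i) = src i"
proof -
  assume i: "i < 2 * m"
  show "flip i < 2 * m" "flip (flip i) = i" "flip i \<noteq> i" using i by (auto simp: flip_def)
  have "src (flip i) = tgt i \<and> tgt (flip i) = src i"
  proof (cases "i < m")
    case True
    then show ?thesis by (simp add: flip_def src_rev tgt_rev)
  next
    case False
    define j where "j = i - m"
    have "i = m + j" "j < m" using False i by (auto simp: j_def)
    then show ?thesis by (simp add: flip_def src_rev tgt_rev)
  qed
  then show "src (flip i) = tgt i" "tgt (flip i) = src i" by simp_all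
qed

lemma sum_flip_support:
  fixes g :: "nat \<Rightarrow> 'a::comm_monoid_add"
  assumes "i < 2 * m" "\<And>l. l \<noteq> i \<Longrightarrow> l \<noteq> flip i \<Longrightarrow> g l = 0"
  shows "(\<Sum>l<2 * m. g l) = g i + g (flip i)"
proof -
  have "(\<Sum>l<2 * m. g l) = (\<Sum>l\<in>{i, flip i}. g l)"
    using assms flip_less by (intro sum.mono_neutral_right) auto
  also have "\<dots> = g i + g (flip i)" using flip_neq[OF assms(1)] by simp
  finally show ?thesis .
qed

text \<open>A quaternionic Hashimoto edge matrix. A step carries the weight of the arc it leaves, so
  a closed word collects the weights of its arcs in order.\<close>

definition nonbacktracking :: "quat mat" where
  "nonbacktracking = mat (2 * m) (2 * m)
     (\<lambda>(i, j). if tgt i = src j \<and> j \<noteq> flip i then q i else 0)"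

definition reversal :: "quat mat" where
  "reversal = mat (2 * m) (2 * m) (\<lambda>(i, j). if j = flip i then - q i else 0)"

definition factor :: "nat \<Rightarrow> quat fps" where
  "factor i = 1 - fps_const (q i * q (flip i)) * fps_X ^ 2"

text \<open>
  If \<open>J\<close> is the weighted permutation matrix of arc reversal then \<open>J\<^sup>2\<close> is diagonal, so
  \<open>(I + tJ)\<^sup>-\<^sup>1 = (I - t\<^sup>2J\<^sup>2)\<^sup>-\<^sup>1(I - tJ)\<close> is explicit. Since \<open>reversal\<close> is \<open>-J\<close>,
  its \<open>one_minus_tM\<close> is \<open>I + tJ\<close>.
\<close>

definition reversal_inv :: "quat fps mat" where
  "reversal_inv = mat (2 * m) (2 * m) (\<lambda>(i, j). if j = i then inverse (factor i)
     else if j = flip i then - (inverse (factor i) * (fps_X * fps_const (q i))) else 0)"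

definition arc_to_target :: "quat fps mat" where
  "arc_to_target = mat (2 * m) n (\<lambda>(i, u). if tgt i = u then fps_X * fps_const (q i) else 0)"

definition source_to_arc :: "quat fps mat" where
  "source_to_arc = mat n (2 * m) (\<lambda>(u, j). if src j = u then 1 else 0)"

lemma carriers [simp]:
  "nonbacktracking \<in> carrier_mat (2 * m) (2 * m)" "reversal \<in> carrier_mat (2 * m) (2 * m)"
  "reversal_inv \<in> carrier_mat (2 * m) (2 * m)" "arc_to_target \<in> carrier_mat (2 * m) n"
  "source_to_arc \<in> carrier_mat n (2 * m)"
  "one_minus_tM nonbacktracking \<in> carrier_mat (2 * m) (2 * m)"
  "one_minus_tM reversal \<in> carrier_mat (2 * m) (2 * m)"
  by (simp_all add: nonbacktracking_def reversal_def reversal_inv_def arc_to_target_def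
      source_to_arc_def one_minus_tM_def)

lemmas dims [simp] = carriers[THEN carrier_matD(1)] carriers[THEN carrier_matD(2)]

text \<open>The product of the two incidence matrices allows every step from an arc to one that
  starts at its target, including the step to the reverse arc; \<open>reversal\<close> removes
  exactly these backtracking steps.\<close>

lemma one_minus_tM_nonbacktracking:
  "one_minus_tM nonbacktracking = one_minus_tM reversal - arc_to_target * source_to_arc"
proof (rule eq_matI)
  fix i j
  assume "i < dim_row (one_minus_tM reversal - arc_to_target * source_to_arc)"
    "j < dim_col (one_minus_tM reversal - arc_to_target * source_to_arc)"
  then have ij: "i < 2 * m" "j < 2 * m" using carriers by auto
  have "(arc_to_target * source_to_arc) $$ (i, j)
      = (\<Sum>u<n. if u = tgt i then (if tgt i = src j then fps_X * fps_const (q i) else 0) else 0)"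
    unfolding mult_mat_entry[OF carriers(4,5) ij]
    using ij by (intro sum.cong) (auto simp: arc_to_target_def source_to_arc_def)
  also have "\<dots> = (if tgt i = src j then fps_X * fps_const (q i) else 0)"
    using tgt_less[OF ij(1)] by simp
  finally have P: "(arc_to_target * source_to_arc) $$ (i, j)
      = (if tgt i = src j then fps_X * fps_const (q i) else 0)" .
  have "(one_minus_tM reversal - arc_to_target * source_to_arc) $$ (i, j)
      = one_minus_tM reversal $$ (i, j) - (arc_to_target * source_to_arc) $$ (i, j)"
    using mult_carrier_mat[OF carriers(4,5)] ij by (intro index_minus_mat(1)) auto
  also have "\<dots> = one_minus_tM nonbacktracking $$ (i, j)"
    unfolding P using ij src_flip[OF ij(1)] flip_neq[OF ij(1)]
    by (auto simp: one_minus_tM_def nonbacktracking_def reversal_def fps_const_neg[symmetric]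
        simp del: fps_const_neg)
  finally show "one_minus_tM nonbacktracking $$ (i, j)
      = (one_minus_tM reversal - arc_to_target * source_to_arc) $$ (i, j)" by simp
qed simp_all

lemma factor_inverse: "inverse (factor i) * factor i = 1"
  by (rule inverse_mult_eq_1) (simp add: factor_def)

text \<open>Row \<open>i\<close> of the left factor lives on \<open>i\<close> and
  \<open>flip i\<close>. Its two terms cancel in column \<open>flip i\<close> and combine to
  \<open>inverse (factor i) * factor i\<close> in column \<open>i\<close>. A left inverse suffices,
  as it is used only through determinants.\<close>

lemma reversal_inv_mult: "reversal_inv * one_minus_tM reversal = 1\<^sub>m (2 * m)"
proof (rule eq_matI)
  fix i j
  assume "i < dim_row (1\<^sub>m (2 * m))" "j < dim_col (1\<^sub>m (2 * m))"
  then have ij: "i < 2 * m" "j < 2 * m" by auto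
  note fi = flip_less[OF ij(1)] flip_neq[OF ij(1)] flip_flip[OF ij(1)]
  have "(reversal_inv * one_minus_tM reversal) $$ (i, j)
      = (\<Sum>l<2 * m. reversal_inv $$ (i, l) * one_minus_tM reversal $$ (l, j))"
    by (rule mult_mat_entry[OF carriers(3,7) ij])
  also have "\<dots> = (\<Sum>l<2 * m. (if l = i \<or> l = flip i then
      reversal_inv $$ (i, l) * one_minus_tM reversal $$ (l, j) else 0))"
    using ij by (intro sum.cong) (auto simp: reversal_inv_def)
  also have "\<dots> = reversal_inv $$ (i, i) * one_minus_tM reversal $$ (i, j)
      + reversal_inv $$ (i, flip i) * one_minus_tM reversal $$ (flip i, j)"
    by (subst sum_flip_support[OF ij(1)]) auto
  also have "\<dots> = (if i = j then 1 else 0)"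
  proof -
    have "fps_X * fps_const (q i) * (fps_X * fps_const (q (flip i)))
        = fps_const (q i * q (flip i)) * fps_X ^ 2"
      unfolding fps_X_const_mult by (rule fps_mult_fps_X_power_commute)
    then have "inverse (factor i) - inverse (factor i) * (fps_X * fps_const (q i))
        * (fps_X * fps_const (q (flip i))) = inverse (factor i) * factor i"
      by (simp add: factor_def right_diff_distrib mult.assoc)
    then show ?thesis
      using ij fi by (auto simp: one_minus_tM_def reversal_def reversal_inv_def factor_inverse
          fps_const_neg[symmetric] simp del: fps_const_neg)
  qed
  finally show "(reversal_inv * one_minus_tM reversal) $$ (i, j) = 1\<^sub>m (2 * m) $$ (i, j)"
    using ij by simp
qed simp_all

text \<open>Each arc leaving \<open>u\<close> gives a forward step, the source of
  \<open>W_tilde\<close>, and a step out and back, the source of \<open>D_tilde\<close>; the latter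
  is diagonal because the reverse arc ends at \<open>u\<close>.\<close>

lemma vertex_matrix_entry:
  assumes "u < n" "v < n"
  shows "(source_to_arc * (reversal_inv * arc_to_target)) $$ (u, v)
    = (\<Sum>i | i < 2 * m \<and> src i = u. inverse (factor i) *
        ((if tgt i = v then fps_X * fps_const (q i) else 0)
         - (if u = v then fps_X ^ 2 * fps_const (q i * q (flip i)) else 0)))"
proof -
  have R: "(reversal_inv * arc_to_target) $$ (i, v) = inverse (factor i) *
        ((if tgt i = v then fps_X * fps_const (q i) else 0)
         - (if src i = v then fps_X ^ 2 * fps_const (q i * q (flip i)) else 0))"
    if i: "i < 2 * m" for i
  proof -
    note fi = flip_less[OF i] flip_neq[OF i] tgt_flip[OF i]
    have "(reversal_inv * arc_to_target) $$ (i, v)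
        = (\<Sum>l<2 * m. reversal_inv $$ (i, l) * arc_to_target $$ (l, v))"
      by (rule mult_mat_entry[OF carriers(3,4) i assms(2)])
    also have "\<dots> = (\<Sum>l<2 * m. (if l = i \<or> l = flip i then
        reversal_inv $$ (i, l) * arc_to_target $$ (l, v) else 0))"
      using i by (intro sum.cong) (auto simp: reversal_inv_def)
    also have "\<dots> = reversal_inv $$ (i, i) * arc_to_target $$ (i, v)
        + reversal_inv $$ (i, flip i) * arc_to_target $$ (flip i, v)"
      by (subst sum_flip_support[OF i]) auto
    also have "\<dots> = inverse (factor i) *
        ((if tgt i = v then fps_X * fps_const (q i) else 0)
         - (if src i = v then fps_X ^ 2 * fps_const (q i * q (flip i)) else 0))"
    proof -
      have "inverse (factor i) * (fps_X * fps_const (q i)) * (fps_X * fps_const (q (flip i)))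
          = inverse (factor i) * (fps_X ^ 2 * fps_const (q i * q (flip i)))"
        by (simp only: mult.assoc fps_X_const_mult[unfolded mult.assoc])
      then show ?thesis
        using i fi assms by (simp add: reversal_inv_def arc_to_target_def right_diff_distrib)
    qed
    finally show ?thesis .
  qed
  have "(source_to_arc * (reversal_inv * arc_to_target)) $$ (u, v)
      = (\<Sum>i<2 * m. source_to_arc $$ (u, i) * (reversal_inv * arc_to_target) $$ (i, v))"
    by (rule mult_mat_entry[OF carriers(5) mult_carrier_mat[OF carriers(3,4)] assms])
  also have "\<dots> = (\<Sum>i | i < 2 * m \<and> src i = u. (reversal_inv * arc_to_target) $$ (i, v))"
    using assms by (intro sum.mono_neutral_cong_right) (auto simp: source_to_arc_def)
  also have "\<dots> = (\<Sum>i | i < 2 * m \<and> src i = u. inverse (factor i) *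
        ((if tgt i = v then fps_X * fps_const (q i) else 0)
         - (if u = v then fps_X ^ 2 * fps_const (q i * q (flip i)) else 0)))"
    using R by (intro sum.cong) auto
  finally show ?thesis .
qed

text \<open>Reversing twice returns to the same arc, so the square is diagonal and the two minus
  signs cancel.\<close>

lemma reversal_pow_even:
  assumes "i < 2 * m" "j < 2 * m"
  shows "(reversal ^\<^sub>m (2 * r)) $$ (i, j) = (if i = j then (q i * q (flip i)) ^ r else 0)"
  using assms(2)
proof (induction r arbitrary: j)
  case 0
  have "dim_row reversal = 2 * m" by (simp add: reversal_def)
  then show ?case using 0 assms by simp
next
  case (Suc r)
  have sq: "(reversal * reversal) $$ (k, l) = (if k = l then q k * q (flip k) else 0)"
    if "k < 2 * m" "l < 2 * m" for k l
  proof -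
    have "(reversal * reversal) $$ (k, l) = (\<Sum>h<2 * m. reversal $$ (k, h) * reversal $$ (h, l))"
      by (rule mult_mat_entry[OF carriers(2,2) that])
    also have "\<dots> = (\<Sum>h<2 * m. if h = flip k then - q k * reversal $$ (flip k, l) else 0)"
      using that by (intro sum.cong) (auto simp: reversal_def)
    also have "\<dots> = (if k = l then q k * q (flip k) else 0)"
      using that flip_less[of k] flip_flip[of k] by (auto simp: reversal_def)
    finally show ?thesis .
  qed
  have c: "reversal ^\<^sub>m (2 * r) \<in> carrier_mat (2 * m) (2 * m)" by (rule pow_carrier_mat) simp
  have "reversal ^\<^sub>m (2 * Suc r) = reversal ^\<^sub>m (2 * r) * (reversal * reversal)"
    using assoc_mult_mat[OF c carriers(2) carriers(2)] by simp
  then have "(reversal ^\<^sub>m (2 * Suc r)) $$ (i, j)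
      = (\<Sum>h<2 * m. (reversal ^\<^sub>m (2 * r)) $$ (i, h) * (reversal * reversal) $$ (h, j))"
    using mult_mat_entry[OF c mult_carrier_mat[OF carriers(2,2)] assms(1) Suc.prems] by simp
  also have "\<dots> = (\<Sum>h<2 * m. if h = i then (q i * q (flip i)) ^ r * (reversal * reversal) $$ (i, j) else 0)"
    using Suc.IH by (intro sum.cong) auto
  also have "\<dots> = (if i = j then (q i * q (flip i)) ^ Suc r else 0)"
    using assms Suc.prems sq by (simp only: power_Suc2) simp
  finally show ?case .
qed

text \<open>Odd powers have zero diagonal. In even powers the arcs \<open>i\<close> and
  \<open>m + i\<close> contribute powers of the two opposite products, whose real parts agree; hence
  one term per edge, doubled.\<close>

lemma trace_reversal_pow:
  "Q0 (trace (reversal ^\<^sub>m k)) = (if even k then 2 * (\<Sum>i<m. Q0 ((q i * q (m + i)) ^ (k div 2))) else 0)"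
proof -
  have c: "reversal ^\<^sub>m l \<in> carrier_mat (2 * m) (2 * m)" for l by (rule pow_carrier_mat) simp
  then have tr: "trace (reversal ^\<^sub>m k) = (\<Sum>i<2 * m. (reversal ^\<^sub>m k) $$ (i, i))"
    by (metis trace_def carrier_matD(1))
  show ?thesis
  proof (cases "even k")
    case True
    then obtain r where k: "k = 2 * r" by blast
    have "Q0 (trace (reversal ^\<^sub>m k)) = (\<Sum>i<2 * m. Q0 ((q i * q (flip i)) ^ r))"
      unfolding tr by (simp add: k reversal_pow_even Q0_sum)
    also have "\<dots> = (\<Sum>i<m. Q0 ((q i * q (flip i)) ^ r)) + (\<Sum>i\<in>{m..<m + m}. Q0 ((q i * q (flip i)) ^ r))"
      using sum.atLeastLessThan_concat[of 0 m "m + m" "\<lambda>i. Q0 ((q i * q (flip i)) ^ r)"]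
      by (simp add: atLeast0LessThan mult_2)
    also have "(\<Sum>i\<in>{m..<m + m}. Q0 ((q i * q (flip i)) ^ r))
        = (\<Sum>i<m. Q0 ((q (m + i) * q i) ^ r))"
      using sum.shift_bounds_nat_ivl[of "\<lambda>i. Q0 ((q i * q (flip i)) ^ r)" 0 m m]
      by (simp add: atLeast0LessThan flip_def add.commute)
    also have "\<dots> = (\<Sum>i<m. Q0 ((q i * q (m + i)) ^ r))"
      by (intro sum.cong refl Q0_mult_power_commute)
    also have "(\<Sum>i<m. Q0 ((q i * q (flip i)) ^ r)) = (\<Sum>i<m. Q0 ((q i * q (m + i)) ^ r))"
      by (simp add: flip_def)
    finally show ?thesis using True by (simp add: k)
  next
    case False
    then obtain r where k: "k = Suc (2 * r)" by (metis oddE Suc_eq_plus1)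
    have "(reversal ^\<^sub>m k) $$ (i, i) = 0" if i: "i < 2 * m" for i
    proof -
      have "(reversal ^\<^sub>m k) $$ (i, i) = (\<Sum>h<2 * m. (reversal ^\<^sub>m (2 * r)) $$ (i, h) * reversal $$ (h, i))"
        unfolding k pow_mat.simps(2) by (rule mult_mat_entry[OF c carriers(2) i i])
      also have "\<dots> = 0"
      proof (intro sum.neutral ballI)
        fix h assume "h \<in> {..<2 * m}"
        moreover have "reversal $$ (i, i) = 0"
          using i flip_neq[OF i] by (auto simp: reversal_def)
        ultimately show "(reversal ^\<^sub>m (2 * r)) $$ (i, h) * reversal $$ (h, i) = 0"
          using reversal_pow_even[OF i, of h r] by (cases "h = i") auto
      qed
      finally show ?thesis .
    qed
    then show ?thesis using False unfolding tr by (simp add: Q0_sum)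
  qed
qed

text \<open>The doubling in \<open>trace_reversal_pow\<close> matches the factor
  \<open>l = 2\<close> in \<open>norm_factor_log_deriv\<close>, so the logarithmic derivatives agree
  in every degree.\<close>

lemma Sdet_t_reversal:
  "Sdet_t (one_minus_tM reversal) = (\<Prod>i<m. norm_factor 2 (q i * q (m + i)))"
proof (rule fps_ext)
  fix k
  have "fps_nth (\<Prod>i\<in>Y. norm_factor 2 (q i * q (m + i))) 0 = 1" for Y
    by (induction Y rule: infinite_finite_induct) (auto simp: norm_factor_nth_0)
  then have z: "fps_nth (Sdet_t (one_minus_tM reversal)) 0
      = fps_nth (\<Prod>i<m. norm_factor 2 (q i * q (m + i))) 0"
    using Sdet_t_one_minus_tM_nth_0[OF carriers(2)] by simp
  have p: "has_log_deriv (\<Prod>i<m. norm_factor 2 (q i * q (m + i)))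
    (\<Sum>i<m. norm_factor_log_deriv 2 (q i * q (m + i)))"
    by (intro has_log_deriv_prod has_log_deriv_norm_factor) simp
  show "fps_nth (Sdet_t (one_minus_tM reversal)) k
      = fps_nth (\<Prod>i<m. norm_factor 2 (q i * q (m + i))) k"
  proof (rule has_log_deriv_unique[OF has_log_deriv_det_psi[OF carriers(2)] p z _ _ order_refl])
    fix l
    show "fps_nth (- Abs_fps (\<lambda>k. if 0 < k then of_real (2 * Q0 (trace (reversal ^\<^sub>m k))) else 0)) l
        = fps_nth (\<Sum>i<m. norm_factor_log_deriv 2 (q i * q (m + i))) l"
      by (simp add: fps_sum_nth norm_factor_log_deriv_def trace_reversal_pow sum_negf sum_distrib_left)
  qed simp
qed

text \<open>Left multiplication by \<open>reversal_inv\<close> turns \<open>I - tM\<close> into the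
  identity minus a product through the vertices. After \<open>psi_t\<close>, where entries commute,
  its two factors can be swapped under the determinant. The determinant of
  \<open>psi_t reversal_inv\<close> is eliminated as the inverse of the one of
  \<open>I + tJ\<close>.\<close>

lemma Sdet_t_nonbacktracking:
  "Sdet_t (one_minus_tM nonbacktracking)
    = Sdet_t (1\<^sub>m n - source_to_arc * (reversal_inv * arc_to_target))
      * (\<Prod>i<m. norm_factor 2 (q i * q (m + i)))"
proof -
  let ?N = "2 * (2 * m)" and ?E = "one_minus_tM reversal" and ?B = "one_minus_tM nonbacktracking"
  let ?A = "reversal_inv * arc_to_target"
  note rc = psi_t.rep_carrier
  have A: "?A \<in> carrier_mat (2 * m) n" by (rule mult_carrier_mat[OF carriers(3,4)])
  have AL: "?A * source_to_arc \<in> carrier_mat (2 * m) (2 * m)"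
    by (rule mult_carrier_mat[OF A carriers(5)])
  have LA: "source_to_arc * ?A \<in> carrier_mat n n"
    by (rule mult_carrier_mat[OF carriers(5) A])
  have "reversal_inv * ?B = reversal_inv * ?E - reversal_inv * (arc_to_target * source_to_arc)"
    unfolding one_minus_tM_nonbacktracking
    by (rule mult_minus_distrib_mat[of _ "2 * m" "2 * m" _ "2 * m"]) (use carriers mult_carrier_mat[OF carriers(4,5)] in auto)
  also have "\<dots> = 1\<^sub>m (2 * m) - ?A * source_to_arc"
    unfolding reversal_inv_mult assoc_mult_mat[OF carriers(3,4,5)] ..
  finally have "psi_t reversal_inv * psi_t ?B = psi_t (1\<^sub>m (2 * m) - ?A * source_to_arc)"
    using psi_t.rep_mult[OF carriers(3) carriers(6)] by simp
  also have "\<dots> = 1\<^sub>m ?N - psi_t ?A * psi_t source_to_arc"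
    using psi_t.rep_diff[OF one_carrier_mat AL] psi_t.rep_mult[OF A carriers(5)]
    by (simp add: psi_t.rep_one)
  finally have "det (psi_t reversal_inv) * det (psi_t ?B)
      = det (1\<^sub>m ?N - psi_t ?A * psi_t source_to_arc)"
    using det_mult[OF rc[OF carriers(3)] rc[OF carriers(6)]] by simp
  also have "\<dots> = det (1\<^sub>m (2 * n) - psi_t source_to_arc * psi_t ?A)"
    by (rule det_one_minus_mult_commute[OF rc[OF A] rc[OF carriers(5)]])
  also have "1\<^sub>m (2 * n) - psi_t source_to_arc * psi_t ?A = psi_t (1\<^sub>m n - source_to_arc * ?A)"
    using psi_t.rep_diff[OF one_carrier_mat LA] psi_t.rep_mult[OF carriers(5) A]
    by (simp add: psi_t.rep_one)
  finally have 1: "det (psi_t reversal_inv) * Sdet_t ?B = Sdet_t (1\<^sub>m n - source_to_arc * ?A)"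
    by (simp add: Sdet_t_def)
  have "det (psi_t reversal_inv) * det (psi_t ?E) = det (psi_t (reversal_inv * ?E))"
    using det_mult[OF rc[OF carriers(3)] rc[OF carriers(7)]] psi_t.rep_mult[OF carriers(3) carriers(7)]
    by simp
  also have "\<dots> = 1" by (simp add: reversal_inv_mult psi_t.rep_one)
  finally have "det (psi_t reversal_inv) * Sdet_t ?E = 1" by (simp add: Sdet_t_def)
  with 1 have "Sdet_t ?B = Sdet_t (1\<^sub>m n - source_to_arc * ?A) * Sdet_t ?E"
    by (metis mult.assoc mult.commute mult_1)
  then show ?thesis by (simp add: Sdet_t_reversal)
qed

end

section \<open>The zeta function as an infinite product\<close>

lemma quat_of_complex_hom:
  "quat_of_complex (a + b) = quat_of_complex a + quat_of_complex b"
  "quat_of_complex (a * b) = quat_of_complex a * quat_of_complex b"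
  "quat_of_complex 0 = 0" "quat_of_complex 1 = 1"
  by (simp_all add: quat_eq_iff quat_of_complex_def)

lemma quat_of_complex_sum: "quat_of_complex (sum f A) = (\<Sum>x\<in>A. quat_of_complex (f x))"
  by (induction A rule: infinite_finite_induct) (simp_all add: quat_of_complex_hom)

lemma fps_quat_of_complex_nth [simp]:
  "fps_nth (fps_quat_of_complex f) k = quat_of_complex (fps_nth f k)"
  by (simp add: fps_quat_of_complex_def)

lemma fps_quat_of_complex_mult:
  "fps_quat_of_complex (f * g) = fps_quat_of_complex f * fps_quat_of_complex g"
  by (rule fps_ext) (simp add: fps_mult_nth quat_of_complex_sum quat_of_complex_hom)

lemma fps_quat_of_complex_one [simp]: "fps_quat_of_complex 1 = 1"
  by (rule fps_ext) (simp add: quat_of_complex_hom)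

lemma fps_quat_of_complex_prod_list:
  "fps_quat_of_complex (prod_list fs) = prod_list (map fps_quat_of_complex fs)"
  by (induction fs) (simp_all add: fps_quat_of_complex_mult)

lemma fps_quat_of_complex_inverse:
  assumes "fps_nth f 0 \<noteq> 0"
  shows "inverse (fps_quat_of_complex f) = fps_quat_of_complex (inverse f)"
  using assms
  by (intro fps_inverse_unique) (simp add: inverse_mult_eq_1' flip: fps_quat_of_complex_mult)

lemma fps_qnormsq_linear:
  assumes "0 < l"
  shows "fps_qnormsq (1 - fps_const x * fps_X ^ l) = fps_quat_of_complex (norm_factor l x)"
proof -
  have c: "fps_qcnj (1 - fps_const x * fps_X ^ l) = 1 - fps_const (qcnj x) * fps_X ^ l"
    using assms by (intro fps_ext) (auto simp: fps_qcnj_def quat_eq_iff)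
  have "fps_const x * fps_X ^ l * (fps_const (qcnj x) * fps_X ^ l)
      = fps_const x * (fps_X ^ l * fps_const (qcnj x)) * fps_X ^ l"
    by (simp only: mult.assoc)
  also have "\<dots> = fps_const x * (fps_const (qcnj x) * fps_X ^ l) * fps_X ^ l"
    by (simp only: fps_mult_fps_X_power_commute)
  also have "\<dots> = fps_const (x * qcnj x) * fps_X ^ (2 * l)"
    by (simp add: mult.assoc[symmetric] mult_2 power_add)
  finally have "fps_qnormsq (1 - fps_const x * fps_X ^ l)
      = 1 - fps_const (x + qcnj x) * fps_X ^ l + fps_const (x * qcnj x) * fps_X ^ (2 * l)"
    unfolding fps_qnormsq_def c
    by (simp add: left_diff_distrib right_diff_distrib distrib_right flip: fps_const_add)
  also have "x + qcnj x = quat_of_complex (of_real (2 * Q0 x))"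
    by (simp add: quat_eq_iff quat_of_complex_def)
  also have "x * qcnj x = quat_of_complex (of_real (qnormsq x))"
    by (simp add: quat_eq_iff quat_of_complex_def qnormsq_def power2_eq_square)
  finally show ?thesis
    using assms by (intro fps_ext) (auto simp: norm_factor_def quat_eq_iff quat_of_complex_def)
qed

text \<open>A fold is independent of the order only for commuting factors. Those indexed by
  \<open>S\<close> come from complex series, hence commute with each other.\<close>

lemma comm_prod_fps_quat_of_complex:
  assumes f: "\<And>x. x \<in> S \<Longrightarrow> f x = fps_quat_of_complex (g x)" and "finite A" "A \<subseteq> S"
  shows "comm_prod f A = fps_quat_of_complex (prod g A)"
proof -
  interpret Finite_Set.comp_fun_commute_on S "\<lambda>x z. f x * z"
  proof
    fix x y assume "x \<in> S" "y \<in> S"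
    then have "f y * f x = f x * f y"
      by (simp add: f mult.commute flip: fps_quat_of_complex_mult)
    then show "(\<lambda>z. f y * z) \<circ> (\<lambda>z. f x * z) = (\<lambda>z. f x * z) \<circ> (\<lambda>z. f y * z)"
      by (auto simp: fun_eq_iff simp flip: mult.assoc)
  qed
  show ?thesis
    using assms(2,3)
  proof (induction A rule: finite_induct)
    case (insert x A)
    then show ?case
      using fold_insert[of x A 1] by (simp add: comm_prod_def f fps_quat_of_complex_mult)
  qed (simp add: comm_prod_def)
qed

text \<open>\<open>1/f - 1/g = (g - f) / (f g)\<close>, and \<open>g - f\<close> has no terms up to
  degree \<open>K\<close>.\<close>

lemma fps_inverse_nth_cong:
  fixes f g :: "complex fps"
  assumes "fps_nth f 0 \<noteq> 0" "fps_nth g 0 \<noteq> 0"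
    and eq: "\<And>k. k \<le> K \<Longrightarrow> fps_nth f k = fps_nth g k"
  shows "fps_nth (inverse f) K = fps_nth (inverse g) K"
proof -
  have "inverse f - inverse g = (g - f) * (inverse f * inverse g)"
    using assms(1,2) by (simp add: algebra_simps inverse_mult_eq_1 inverse_mult_eq_1'
        mult.assoc[symmetric])
  moreover have "fps_nth ((g - f) * (inverse f * inverse g)) K = 0"
    unfolding fps_mult_nth by (intro sum.neutral) (auto simp: eq)
  ultimately show ?thesis by (metis eq_iff_diff_eq_0 fps_sub_nth)
qed

lemma fps_inverse_prod:
  fixes g :: "'b \<Rightarrow> complex fps"
  shows "(\<Prod>x\<in>A. inverse (g x)) = inverse (prod g A)"
  by (induction A rule: infinite_finite_induct) (simp_all add: fps_inverse_mult)

text \<open>Convergence is \<open>t\<close>-adic, so each coefficient has to become constant along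
  the finite subsets; \<open>X0\<close> is a set from which on the coefficients up to
  \<open>K\<close> are final. Inversion preserves this.\<close>

lemma fps_infprod_fps_quat_of_complex:
  assumes f: "\<And>x. x \<in> S \<Longrightarrow> f x = fps_quat_of_complex (inverse (g x))"
    and g: "\<And>x. x \<in> S \<Longrightarrow> fps_nth (g x) 0 = 1" and h: "fps_nth h 0 = 1"
    and approx: "\<And>K. \<exists>X0. finite X0 \<and> X0 \<subseteq> S \<and> (\<forall>X. finite X \<and> X0 \<subseteq> X \<and> X \<subseteq> S \<longrightarrow>
      (\<forall>k\<le>K. fps_nth (prod g X) k = fps_nth h k))"
  shows "fps_infprod f S = fps_quat_of_complex (inverse h)"
  unfolding fps_infprod_def
proof (rule tendsto_Lim)
  show "(comm_prod f \<longlongrightarrow> fps_quat_of_complex (inverse h)) (finite_subsets_at_top S)"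
  proof (rule tendsto_fpsI)
    fix K
    obtain X0 where X0: "finite X0" "X0 \<subseteq> S"
      "\<And>X k. finite X \<Longrightarrow> X0 \<subseteq> X \<Longrightarrow> X \<subseteq> S \<Longrightarrow> k \<le> K \<Longrightarrow> fps_nth (prod g X) k = fps_nth h k"
      using approx[of K] by auto
    have "fps_nth (comm_prod f X) K = fps_nth (fps_quat_of_complex (inverse h)) K"
      if X: "finite X" "X0 \<subseteq> X" "X \<subseteq> S" for X
    proof -
      have "comm_prod f X = fps_quat_of_complex (inverse (prod g X))"
        using comm_prod_fps_quat_of_complex[of S f "\<lambda>x. inverse (g x)" X] f X
        by (simp add: fps_inverse_prod)
      moreover have "fps_nth (inverse (prod g X)) K = fps_nth (inverse h) K"
        using X0(3)[OF X] h by (intro fps_inverse_nth_cong) auto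
      ultimately show ?thesis by simp
    qed
    then show "\<forall>\<^sub>F X in finite_subsets_at_top S.
        fps_nth (comm_prod f X) K = fps_nth (fps_quat_of_complex (inverse h)) K"
      using X0 by (auto simp: eventually_finite_subsets_at_top)
  qed
qed simp

section \<open>Reduced cycles as words with admissible consecutive letters\<close>

lemma path_prod_guarded:
  "path_prod (\<lambda>i j. if P i j then c i else (0 :: 'a::ring_1)) xs j
     = (if successively P (xs @ [j]) then prod_list (map c xs) else 0)"
proof (induction xs)
  case (Cons x xs)
  then show ?case by (cases xs) auto
qed simp

lemma has_backtracking_iff:
  "has_backtracking p \<longleftrightarrow> \<not> successively (\<lambda>a b. b \<noteq> prod.swap a) p"
  by (simp add: has_backtracking_def successively_conv_nth)

lemma pcas_iff:
  "D \<noteq> [] \<Longrightarrow>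
    pcas u D v \<longleftrightarrow> fst (hd D) = u \<and> successively (\<lambda>a b. snd a = fst b) D \<and> snd (last D) = v"
proof (induction D arbitrary: u rule: list_nonempty_induct)
  case (cons a D)
  have "pcas u (a # D) v \<longleftrightarrow> fst a = u \<and> pcas (snd a) D v" by simp
  also have "\<dots> \<longleftrightarrow> fst a = u \<and> fst (hd D) = snd a \<and>
      successively (\<lambda>a b. snd a = fst b) D \<and> snd (last D) = v"
    by (simp only: cons.IH)
  also have "\<dots> \<longleftrightarrow> fst (hd (a # D)) = u \<and>
      successively (\<lambda>a b. snd a = fst b) (a # D) \<and> snd (last (a # D)) = v"
    using cons.hyps by (simp add: successively_Cons eq_commute[of "fst (hd D)"])
  finally show ?case .
qed simp

text \<open>Repeating the first arc at the end turns closedness and the absence of backtracking,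
  also at the seam of two copies, into one condition on consecutive arcs, the form produced by
  \<open>path_prod_guarded\<close>.\<close>

lemma reduced_cycle_iff:
  assumes wf: "pair_wf_digraph G" and C: "C \<noteq> []" "set C \<subseteq> parcs G"
  shows "reduced_cycle G C \<longleftrightarrow>
    successively (\<lambda>a b. snd a = fst b \<and> b \<noteq> prod.swap a) (C @ [hd C])"
proof -
  interpret pair_wf_digraph G by (rule wf)
  let ?P = "\<lambda>a b. snd a = fst b" and ?Q = "\<lambda>a b :: 'a \<times> 'a. b \<noteq> prod.swap a"
  have "(\<exists>u. awalk u C u) \<longleftrightarrow> successively ?P C \<and> snd (last C) = fst (hd C)"
    using C(2) hd_in_set[OF C(1)] arc_fst_in_verts[of "hd C"] by (auto simp: awalk_def pcas_iff[OF C(1)])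
  also have "\<dots> \<longleftrightarrow> successively ?P (C @ [hd C])"
    using C by (auto simp: successively_append_iff)
  finally have 1: "(\<exists>u. awalk u C u) \<longleftrightarrow> successively ?P (C @ [hd C])" .
  have 2: "\<not> has_backtracking C \<and> \<not> has_backtracking (C @ C) \<longleftrightarrow> successively ?Q (C @ [hd C])"
    using C by (auto simp: has_backtracking_iff successively_append_iff)
  have 3: "successively (\<lambda>a b. ?P a b \<and> ?Q a b) D \<longleftrightarrow> successively ?P D \<and> successively ?Q D" for D
    by (auto simp: successively_conv_nth)
  show ?thesis
    unfolding reduced_cycle_def 3 using C 1 2 by blast
qed

theorem theorem7p2:
  fixes G :: "'a pair_pre_digraph"
    and n m :: nat
    and v :: "nat \<Rightarrow> 'a"
    and e :: "nat \<Rightarrow> 'a \<times> 'a"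
    and w :: "'a \<times> 'a \<Rightarrow> quat"
  assumes "pair_graph G"
    and "Digraph_Component.connected (with_proj G)"
    and "bij_betw v {..<n} (pverts G)"
    and "bij_betw e {1..2*m} (parcs G)"
    and "\<And>k. k \<in> {1..m} \<Longrightarrow> e (m + k) = prod.swap (e k)"
    and "\<And>a. a \<in> pverts G \<times> pverts G \<Longrightarrow> a \<notin> parcs G \<Longrightarrow> w a = 0"
  shows "inverse (zeta_H G m e w) =
      fps_quat_of_complex
        (Sdet_t (1\<^sub>m n - fps_X \<cdot>\<^sub>m W_tilde G w n v + fps_X ^ 2 \<cdot>\<^sub>m D_tilde G w n v))
      * prod_list (map (\<lambda>i. edge_factor w (e i) * fps_qcnj (edge_factor w (e i))) [1..<Suc m])"
proof -
  interpret G: pair_graph G by (rule assms(1))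
  have wf: "pair_wf_digraph G" by (rule G.pair_wf_digraph)
  note v = assms(3) and e = assms(4) and e_rev = assms(5)
  define idx where "idx = inv_into {..<n} v"
  have idx: "idx u < n" "v (idx u) = u" if "u \<in> pverts G" for u
    using v that inv_into_into[of u v "{..<n}"] f_inv_into_f[of u v "{..<n}"]
    by (auto simp: idx_def bij_betw_def)
  have idx_v: "idx (v i) = i" if "i < n" for i
    using v that by (simp add: idx_def bij_betw_def)
  have idx_iff: "idx u = x \<longleftrightarrow> u = v x" if "u \<in> pverts G" "x < n" for u x
    using idx(2)[OF that(1)] idx_v[OF that(2)] by auto
  have e_arc: "e (Suc i) \<in> parcs G" if "i < 2 * m" for i
    using e that by (auto simp: bij_betw_def)
  have ends: "fst (e (Suc i)) \<in> pverts G" "snd (e (Suc i)) \<in> pverts G" if "i < 2 * m" for i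
    using e_arc[OF that] G.arc_fst_in_verts G.arc_snd_in_verts by auto
  have e_inj: "e i = e j \<longleftrightarrow> i = j" if "i \<in> {1..2 * m}" "j \<in> {1..2 * m}" for i j
    by (rule inj_on_eq_iff[OF bij_betw_imp_inj_on[OF e] that])
  have e_rev': "e (Suc (m + i)) = prod.swap (e (Suc i))" if "i < m" for i
    using e_rev[of "Suc i"] that by simp

  \<comment> \<open>From here on arcs are counted from 0, as in \<open>arc_matrices\<close>, whereas
    \<open>e\<close> starts at 1.\<close>
  define q where "q i = w (e (Suc i))" for i
  define src where "src i = idx (fst (e (Suc i)))" for i
  define tgt where "tgt i = idx (snd (e (Suc i)))" for i
  interpret A: arc_matrices m n q src tgt
  proof
    fix i assume "i < 2 * m"
    then show "src i < n" "tgt i < n" using idx ends by (auto simp: src_def tgt_def)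
  next
    fix i assume "i < m"
    then show "src (m + i) = tgt i" "tgt (m + i) = src i"
      by (simp_all add: src_def tgt_def e_rev')
  qed
  have e_flip: "e (Suc (A.flip i)) = prod.swap (e (Suc i))" if "i < 2 * m" for i
  proof (cases "i < m")
    case True
    then show ?thesis by (simp add: A.flip_def e_rev')
  next
    case False
    then show ?thesis using that e_rev'[of "i - m"] by (simp add: A.flip_def)
  qed
  have factor: "A.factor i = edge_factor w (e (Suc i))" if "i < 2 * m" for i
    by (simp add: A.factor_def edge_factor_def q_def e_flip[OF that])
  have src_iff: "src i = x \<longleftrightarrow> fst (e (Suc i)) = v x" and tgt_iff: "tgt i = x \<longleftrightarrow> snd (e (Suc i)) = v x"
    if "i < 2 * m" "x < n" for i x
    using that by (simp_all add: src_def tgt_def idx_iff ends)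

  define P where "P i j \<longleftrightarrow> snd (e i) = fst (e j) \<and> e j \<noteq> prod.swap (e i)" for i j
  define a where "a i j = (if P i j then w (e i) else 0)" for i j
  have nb: "A.nonbacktracking = mat (2 * m) (2 * m) (\<lambda>(i, j). a (Suc i) (Suc j))"
  proof (rule eq_matI, simp_all)
    fix i j assume ij: "i < 2 * m" "j < 2 * m"
    have "tgt i = src j \<longleftrightarrow> snd (e (Suc i)) = fst (e (Suc j))"
      using ij ends idx by (simp add: tgt_iff A.src_less) (simp add: src_def)
    moreover have "e (Suc j) = prod.swap (e (Suc i)) \<longleftrightarrow> j = A.flip i"
      using ij A.flip_less[OF ij(1)] e_inj[of "Suc j" "Suc (A.flip i)"] by (simp flip: e_flip)
    ultimately show "A.nonbacktracking $$ (i, j) = a (Suc i) (Suc j)"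
      using ij by (simp add: A.nonbacktracking_def a_def P_def q_def)
  qed

  \<comment> \<open>The zeta function as a determinant over arcs\<close>
  let ?S = "{C. reduced_cycle G C \<and> (\<exists>x \<in> lyndon_words {1..2*m}. C = map e x)}"
  define h where "h = Sdet_t (one_minus_tM A.nonbacktracking)"
  have h0: "fps_nth h 0 = 1"
    unfolding h_def by (rule Sdet_t_one_minus_tM_nth_0[OF A.carriers(1)])
  \<comment> \<open>A Lyndon word that spells no reduced cycle meets a forbidden transition and has
    weight 0, so its factor 1 does not disturb the product over cycles.\<close>
  have cyc: "cyc_prod a x = (if reduced_cycle G (map e x) then path_weight w (map e x) else 0)"
    if x: "x \<in> lyndon_words {1..2*m}" for x
  proof -
    have "map e x \<noteq> []" "set (map e x) \<subseteq> parcs G"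
      using x e by (auto simp: lyndon_words_iff bij_betw_def)
    then have "reduced_cycle G (map e x) \<longleftrightarrow> successively P (x @ [hd x])"
      using x by (simp add: reduced_cycle_iff[OF wf] lyndon_words_iff successively_append_iff
          successively_map P_def hd_map last_map)
    moreover have "cyc_prod a x = (if successively P (x @ [hd x]) then prod_list (map (\<lambda>i. w (e i)) x) else 0)"
      unfolding cyc_prod_def a_def by (rule path_prod_guarded)
    ultimately show ?thesis by (simp add: path_weight_def comp_def)
  qed
  \<comment> \<open>The zeta product runs over arc sequences, the determinant formula over index
    words; injectivity allows reindexing.\<close>
  have inj: "inj_on (map e) (lyndon_words {1..2*m})"
  proof (rule inj_onI)
    fix x y assume "x \<in> lyndon_words {1..2*m}" "y \<in> lyndon_words {1..2*m}" "map e x = map e y"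
    moreover from this have "inj_on e (set x \<union> set y)"
      by (intro inj_on_subset[OF bij_betw_imp_inj_on[OF e]]) (simp add: lyndon_words_iff)
    ultimately show "x = y" by (simp add: inj_on_map_eq_map)
  qed
  have "zeta_H G m e w = fps_quat_of_complex (inverse h)"
    unfolding zeta_H_def
  proof (rule fps_infprod_fps_quat_of_complex[where
        g = "\<lambda>C. norm_factor (length C) (path_weight w C)", OF _ _ h0])
    fix C assume "C \<in> ?S"
    then have "0 < length C" by (auto simp: lyndon_words_iff)
    then show "inverse (fps_qnormsq (1 - fps_const (path_weight w C) * fps_X ^ length C))
        = fps_quat_of_complex (inverse (norm_factor (length C) (path_weight w C)))"
      and "fps_nth (norm_factor (length C) (path_weight w C)) 0 = 1"
      by (simp_all add: fps_qnormsq_linear fps_quat_of_complex_inverse norm_factor_nth_0)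
  next
    fix K
    let ?L = "{x \<in> lyndon_words {1..2*m}. length x \<le> K}"
    have "?L \<subseteq> (\<Union>k\<le>K. words {1..2*m} k)" by (auto simp: lyndon_words_iff words_def)
    then have finL: "finite ?L" by (rule finite_subset) (auto simp: finite_words)
    show "\<exists>X0. finite X0 \<and> X0 \<subseteq> ?S \<and> (\<forall>X. finite X \<and> X0 \<subseteq> X \<and> X \<subseteq> ?S \<longrightarrow>
      (\<forall>k\<le>K. fps_nth (\<Prod>C\<in>X. norm_factor (length C) (path_weight w C)) k = fps_nth h k))"
    \<comment> \<open>Starting from all cycles in \<open>?S\<close> of length at most
      \<open>K\<close> suffices: longer ones affect only coefficients beyond
      \<open>K\<close>.\<close>
    proof (intro exI[of _ "?S \<inter> map e ` ?L"] conjI allI impI)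
      fix X k assume X: "finite X \<and> ?S \<inter> map e ` ?L \<subseteq> X \<and> X \<subseteq> ?S" and k: "k \<le> K"
      define Y where "Y = {x \<in> lyndon_words {1..2*m}. map e x \<in> X}"
      have inj_Y: "inj_on (map e) Y" by (rule inj_on_subset[OF inj]) (auto simp: Y_def)
      have XY: "X = map e ` Y" using X by (auto simp: Y_def)
      have "finite Y" using X XY inj_Y by (metis finite_imageD)
      have "(\<Prod>C\<in>X. norm_factor (length C) (path_weight w C))
          = (\<Prod>x\<in>Y. norm_factor (length x) (path_weight w (map e x)))"
        unfolding XY by (subst prod.reindex[OF inj_Y]) simp
      also have "\<dots> = (\<Prod>x\<in>Y. norm_factor (length x) (cyc_prod a x))"
        using X by (intro prod.cong) (auto simp: Y_def cyc)
      finally show "fps_nth (\<Prod>C\<in>X. norm_factor (length C) (path_weight w C)) k = fps_nth h k"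
        unfolding h_def nb
      proof (simp only:, intro Sdet_t_lyndon_product[where K = K, symmetric])
        fix p assume p: "p \<in> lyndon_words {1..2*m}" "length p \<le> K" "cyc_prod a p \<noteq> 0"
        then have "reduced_cycle G (map e p)" by (simp add: cyc split: if_splits)
        with p X show "p \<in> Y" by (auto simp: Y_def)
      qed (use \<open>finite Y\<close> k in \<open>auto simp: Y_def\<close>)
    qed (use finL in auto)
  qed
  then have "inverse (zeta_H G m e w) = fps_quat_of_complex h"
    using h0 by (simp add: fps_quat_of_complex_inverse inverse_mult_eq_1)

  \<comment> \<open>The passage to the vertex matrices\<close>
  also have "h = Sdet_t (1\<^sub>m n - A.source_to_arc * (A.reversal_inv * A.arc_to_target))
      * (\<Prod>i<m. norm_factor 2 (q i * q (m + i)))"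
    unfolding h_def by (rule A.Sdet_t_nonbacktracking)
  also have "1\<^sub>m n - A.source_to_arc * (A.reversal_inv * A.arc_to_target)
      = 1\<^sub>m n - fps_X \<cdot>\<^sub>m W_tilde G w n v + fps_X ^ 2 \<cdot>\<^sub>m D_tilde G w n v" (is "?M1 = ?M2")
  proof (rule eq_matI)
    fix x y assume "x < dim_row ?M2" "y < dim_col ?M2"
    then have xy: "x < n" "y < n" by (simp_all add: D_tilde_def)
    let ?ef = "\<lambda>a. inverse (edge_factor w a)"
    let ?c = "\<lambda>a. fps_const (w a * w (prod.swap a))"
    let ?T = "{a. a \<in> parcs G \<and> fst a = v x}"
    have finT: "finite ?T" using G.pair_finite_arcs by simp
    have bij: "bij_betw (\<lambda>i. e (Suc i)) {i. i < 2 * m \<and> src i = x} ?T"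
    proof (rule bij_betw_imageI)
      show "inj_on (\<lambda>i. e (Suc i)) {i. i < 2 * m \<and> src i = x}"
        by (auto simp: inj_on_def e_inj)
      have "b \<in> (\<lambda>i. e (Suc i)) ` {i. i < 2 * m \<and> src i = x}" if b: "b \<in> ?T" for b
      proof -
        have "b \<in> e ` {1..2 * m}" using b bij_betw_imp_surj_on[OF e] by simp
        then obtain k where "k \<in> {1..2 * m}" "b = e k" by blast
        then show ?thesis
          using b xy src_iff[of "k - 1" x] by (intro image_eqI[of _ _ "k - 1"]) auto
      qed
      moreover have "e (Suc i) \<in> ?T" if "i \<in> {i. i < 2 * m \<and> src i = x}" for i
        using that e_arc[of i] src_iff[of i x] xy by simp
      ultimately show "(\<lambda>i. e (Suc i)) ` {i. i < 2 * m \<and> src i = x} = ?T"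
        by blast
    qed
    have "(A.source_to_arc * (A.reversal_inv * A.arc_to_target)) $$ (x, y)
      = (\<Sum>i | i < 2 * m \<and> src i = x. ?ef (e (Suc i)) *
        ((if snd (e (Suc i)) = v y then fps_X * fps_const (w (e (Suc i))) else 0)
         - (if x = y then fps_X ^ 2 * ?c (e (Suc i)) else 0)))"
      unfolding A.vertex_matrix_entry[OF xy]
      by (intro sum.cong) (auto simp: factor tgt_iff xy q_def e_flip)
    also have "\<dots> = (\<Sum>a\<in>?T. ?ef a * ((if snd a = v y then fps_X * fps_const (w a) else 0)
         - (if x = y then fps_X ^ 2 * ?c a else 0)))"
      by (rule sum.reindex_bij_betw[OF bij])
    \<comment> \<open>An arc is determined by its ends, so at most one arc leaving
      \<open>v x\<close> contributes to \<open>W_tilde\<close>; the powers of \<open>t\<close> are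
      central and move to the front.\<close>
    also have "\<dots> = (\<Sum>a\<in>?T. (if a = (v x, v y) then fps_X * (?ef a * fps_const (w a)) else 0)
         - (if x = y then fps_X ^ 2 * (?ef a * ?c a) else 0))"
    proof (intro sum.cong refl)
      fix b assume b: "b \<in> ?T"
      have "?ef b * (fps_X * c) = fps_X * (?ef b * c)" for c
        by (metis fps_mult_fps_X_commute mult.assoc)
      moreover have "snd b = v y \<longleftrightarrow> b = (v x, v y)" using b by (cases b) auto
      moreover have "?ef b * (fps_X ^ 2 * c) = fps_X ^ 2 * (?ef b * c)" for c
        by (metis fps_mult_fps_X_power_commute mult.assoc)
      ultimately show "?ef b * ((if snd b = v y then fps_X * fps_const (w b) else 0)
           - (if x = y then fps_X ^ 2 * ?c b else 0))
        = (if b = (v x, v y) then fps_X * (?ef b * fps_const (w b)) else 0)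
           - (if x = y then fps_X ^ 2 * (?ef b * ?c b) else 0)"
        by (simp only: right_diff_distrib if_distrib[of "\<lambda>x. ?ef b * x"] mult_zero_right)
    qed
    also have "\<dots> = fps_X * W_tilde G w n v $$ (x, y) - fps_X ^ 2 * D_tilde G w n v $$ (x, y)"
      using xy finT
      by (simp add: sum_subtractf W_tilde_def D_tilde_def sum_distrib_left)
    finally show "?M1 $$ (x, y) = ?M2 $$ (x, y)"
      using xy by (simp add: W_tilde_def D_tilde_def del: index_mult_mat(1))
  qed (simp_all add: D_tilde_def)
  also have "(\<Prod>i<m. norm_factor 2 (q i * q (m + i)))
      = (\<Prod>i\<in>{1..m}. norm_factor 2 (w (e i) * w (prod.swap (e i))))"
    by (simp add: prod.atLeast1_atMost_eq q_def e_rev')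
  also have "\<dots> = prod_list (map (\<lambda>i. norm_factor 2 (w (e i) * w (prod.swap (e i)))) [1..<Suc m])"
    by (subst prod.distinct_set_conv_list[symmetric]) (auto intro: prod.cong)
  also have "fps_quat_of_complex (Sdet_t ?M2 * \<dots>) = fps_quat_of_complex (Sdet_t ?M2)
      * prod_list (map (\<lambda>i. fps_quat_of_complex (norm_factor 2 (w (e i) * w (prod.swap (e i))))) [1..<Suc m])"
    by (simp add: fps_quat_of_complex_mult fps_quat_of_complex_prod_list comp_def)
  also have "(\<lambda>i. fps_quat_of_complex (norm_factor 2 (w (e i) * w (prod.swap (e i)))))
      = (\<lambda>i. edge_factor w (e i) * fps_qcnj (edge_factor w (e i)))"
    using fps_qnormsq_linear[of 2] by (simp add: fun_eq_iff edge_factor_def fps_qnormsq_def)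
  finally show ?thesis .
qed

end
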